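(* Let $r\in\mathbb{N}$ and $k\in\mathbb{Z}_+$ with $k\leqslant r-1$. For $N\geqslant M_{-1}$, let $\lambda_N\geqslant 0$ be such that $N=\left\|u_{\lambda_N}^{(r)}\right\|_2$, and consider the functional $S_{N,-1}:L_2\to\mathbb{R}$, \[ S_{N,-1}f=\int_{-1}^1u^{(r)}_{\lambda_N}(x)f(x)\,dx,\qquad f\in L_2 . \] Then, for $N\in[0,M_{-1})$, $E_N\left(D^k_{-1};W^r_2\right)=+\infty$, and, for $N\geqslant M_{-1}$, \[ E_N\left(D^k_{-1};W^r_2\right)=U\left(D^k_{-1};S_{N,-1};W^r_2\right)=\left\|u_{\lambda_N}\right\|_2 . \]
   Context: Let $\mathbb{I}=[-1,1]$, $L_2=L_2(\mathbb{I})$ (real-valued functions) with norm $\|f\|_2=\left(\int_{-1}^1|f(x)|^2\,dx\right)^{1/2}$. For $m\in\mathbb{N}$, $L_2^m$ is the space of functions $f:\mathbb{I}\to\mathbb{R}$ having absolutely continuous derivative $f^{(m-1)}$ and such that $f^{(m)}\in L_2$. Let $W^r_2=\{f\in L_2^r:\|f^{(r)}\|_2\leqslant 1\}$. For $\lambda\geqslant 0$ (with $r,k$ fixed), $u_\lambda\in L_2^{2r}$ denotes the unique solution of the boundary value problem \[ \begin{cases}(-1)^ru^{(2r)}(x)+\lambda u(x)=0,& x\in(-1,1),\\ u^{(s)}(-1)=(-1)^{k-1}\delta_{r-k-1,s},& s=0,1,\ldots,r-1,\\ u^{(s)}(1)=0,& s=0,1,\ldots,r-1,\end{cases} \] where $\delta_{i,j}$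 is the Kronecker symbol. $M_{-1}$ is the sharp (smallest possible) constant in the inequality $|Q^{(k)}(-1)|\leqslant M_{-1}\|Q\|_2$ for all $Q\in\mathcal{P}_{r-1}$, where $\mathcal{P}_{r-1}$ is the set of real algebraic polynomials of degree at most $r-1$. $D^k_{-1}$ is the functional $f\mapsto f^{(k)}(-1)$ with domain $L_2^r$. For a linear functional $S:L_2\to\mathbb{R}$, \[ U(D^k_{-1};S;W^r_2)=\sup_{f\in W^r_2}|f^{(k)}(-1)-Sf|, \] and $E_N(D^k_{-1};W^r_2)=\inf U(D^k_{-1};S;W^r_2)$, the infimum being over all bounded linear functionals $S:L_2\to\mathbb{R}$ with norm $\|S\|\leqslant N$. *)

theory Defs
  imports "HOL-Analysis.Analysis" "HOL-Computational_Algebra.Polynomial"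
begin

text \<open>
  Functions on \<open>\<I> = [-1,1]\<close> are represented by functions on \<open>real\<close>. Every notion below depends
  only on their values on \<open>\<I>\<close>; in particular derivatives are taken within \<open>\<I>\<close>, hence one-sided at
  the endpoints.
\<close>

abbreviation II :: "real set" where
  "II \<equiv> {-1..1}"

definition L2 :: "(real \<Rightarrow> real) set" where
  "L2 = {f. f \<in> borel_measurable (lebesgue_on II) \<and> integrable (lebesgue_on II) (\<lambda>x. \<bar>f x\<bar>\<^sup>2)}"

definition L2norm :: "(real \<Rightarrow> real) \<Rightarrow> real" where
  "L2norm f = sqrt (LINT x|lebesgue_on II. \<bar>f x\<bar>\<^sup>2)"

definition D :: "nat \<Rightarrow> (real \<Rightarrow> real) \<Rightarrow> real \<Rightarrow> real" where
  "D j = ((\<lambda>f x. vector_derivative f (at x within II)) ^^ j)"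

text \<open>
  The usual \<open>\<epsilon>\<close>-\<open>\<delta>\<close> definition. A division \<open>d\<close> of a set \<open>T\<close> is a finite family of compact intervals
  with disjoint interiors and union \<open>T\<close>; the interval \<open>K\<close> is \<open>[Inf K, Sup K]\<close>.
\<close>

definition abs_continuous_on :: "real set \<Rightarrow> (real \<Rightarrow> real) \<Rightarrow> bool" where
  "abs_continuous_on A f \<longleftrightarrow>
    (\<forall>\<epsilon>>0. \<exists>\<delta>>0. \<forall>d T. d division_of T \<and> T \<subseteq> A \<and> (\<Sum>K\<in>d. Sup K - Inf K) < \<delta>
      \<longrightarrow> (\<Sum>K\<in>d. \<bar>f (Sup K) - f (Inf K)\<bar>) < \<epsilon>)"

text \<open>
  The space \<open>L\<^sub>2\<^sup>m\<close>, for \<open>m \<ge> 1\<close>. The derivative of order \<open>m\<close> exists only almost everywhere. Its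
  almost everywhere existence, which follows from absolute continuity, is listed because
  \<open>vector_derivative\<close> is a total function with unspecified values where no derivative exists.
\<close>

definition L2_Sobolev :: "nat \<Rightarrow> (real \<Rightarrow> real) set" where
  "L2_Sobolev m = {f. (\<forall>j<m - 1. \<forall>x\<in>II. D j f differentiable (at x within II))
     \<and> abs_continuous_on II (D (m - 1) f)
     \<and> (AE x in lebesgue_on II. D (m - 1) f differentiable (at x within II))
     \<and> D m f \<in> L2}"

definition W2 :: "nat \<Rightarrow> (real \<Rightarrow> real) set" where
  "W2 r = {f \<in> L2_Sobolev r. L2norm (D r f) \<le> 1}"

definition bvp_solution :: "nat \<Rightarrow> nat \<Rightarrow> real \<Rightarrow> (real \<Rightarrow> real) \<Rightarrow> bool" where
  "bvp_solution r k lam u \<longleftrightarrow> u \<in> L2_Sobolev (2 * r)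
     \<and> (\<forall>x\<in>{-1<..<1}. (-1) ^ r * D (2 * r) u x + lam * u x = 0)
     \<and> (\<forall>s<r. D s u (-1) = (-1) powi (int k - 1) * (if s = r - k - 1 then 1 else 0))
     \<and> (\<forall>s<r. D s u 1 = 0)"

text \<open>The value \<open>0\<close> outside \<open>\<I>\<close> singles out one representative of the solution on \<open>\<I>\<close>.\<close>

definition u_sol :: "nat \<Rightarrow> nat \<Rightarrow> real \<Rightarrow> real \<Rightarrow> real" where
  "u_sol r k lam = (THE u. bvp_solution r k lam u \<and> (\<forall>x. x \<notin> II \<longrightarrow> u x = 0))"

definition M_left :: "nat \<Rightarrow> nat \<Rightarrow> real" where
  "M_left r k = Inf {M. \<forall>Q :: real poly. degree Q \<le> r - 1 \<longrightarrow>
     \<bar>poly ((pderiv ^^ k) Q) (-1)\<bar> \<le> M * L2norm (poly Q)}"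

text \<open>
  Functionals on the space of square integrable functions are functionals on representatives;
  boundedness makes them respect equality almost everywhere.
\<close>

definition bounded_linear_L2 :: "((real \<Rightarrow> real) \<Rightarrow> real) \<Rightarrow> bool" where
  "bounded_linear_L2 S \<longleftrightarrow>
     (\<forall>f\<in>L2. \<forall>g\<in>L2. S (\<lambda>x. f x + g x) = S f + S g)
     \<and> (\<forall>c. \<forall>f\<in>L2. S (\<lambda>x. c * f x) = c * S f)
     \<and> (\<exists>K. \<forall>f\<in>L2. \<bar>S f\<bar> \<le> K * L2norm f)"

definition onorm_L2 :: "((real \<Rightarrow> real) \<Rightarrow> real) \<Rightarrow> real" where
  "onorm_L2 S = (SUP f\<in>L2. \<bar>S f\<bar> / L2norm f)"

definition deviation ::
  "((real \<Rightarrow> real) \<Rightarrow> real) \<Rightarrow> ((real \<Rightarrow> real) \<Rightarrow> real) \<Rightarrow> (real \<Rightarrow> real) set \<Rightarrow> ereal" where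
  "deviation A S W = (SUP f\<in>W. ereal \<bar>A f - S f\<bar>)"

definition best_approx ::
  "real \<Rightarrow> ((real \<Rightarrow> real) \<Rightarrow> real) \<Rightarrow> (real \<Rightarrow> real) set \<Rightarrow> ereal" where
  "best_approx N A W = (INF S\<in>{S. bounded_linear_L2 S \<and> onorm_L2 S \<le> N}. deviation A S W)"

definition D_left :: "nat \<Rightarrow> (real \<Rightarrow> real) \<Rightarrow> real" where
  "D_left k f = D k f (-1)"

definition S_left :: "nat \<Rightarrow> nat \<Rightarrow> real \<Rightarrow> (real \<Rightarrow> real) \<Rightarrow> real" where
  "S_left r k lam f = (LINT x|lebesgue_on II. D r (u_sol r k lam) x * f x)"

end

theory Submission
  imports Defs "Jordan_Normal_Form.Determinant"
begin

text \<open>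
  Write \<open>u\<close> for the solution of the boundary value problem with parameter \<open>lam\<close>. Integrating by parts
  \<open>r\<close> times, the boundary conditions leave
  \<open>f\<^bsup>(k)\<^esup>(-1) = \<integral> u\<^bsup>(r)\<^esup> f - (-1)\<^bsup>r\<^esup> \<integral> u f\<^bsup>(r)\<^esup>\<close>, so by the Cauchy-Schwarz inequality the deviation of
  the functional \<open>f \<mapsto> \<integral> u\<^bsup>(r)\<^esup> f\<close> is the norm of \<open>u\<close>; it is attained when \<open>f\<^bsup>(r)\<^esup>\<close> is a multiple
  of \<open>u\<close>. No functional of the same norm does better: for \<open>lam > 0\<close> test it at \<open>f = u\<^bsup>(r)\<^esup>\<close>, for
  which the differential equation makes both Cauchy-Schwarz inequalities equalities; for \<open>lam = 0\<close>
  the function \<open>u\<^bsup>(r)\<^esup>\<close> is a polynomial of degree less than \<open>r\<close>, on which the functional must agree with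
  \<open>f \<mapsto> f\<^bsup>(k)\<^esup>(-1)\<close>, and this together with the bound on its norm determines it. The latter polynomial
  also represents the functional on polynomials, so its norm is the constant \<open>M\<close>.

  The norm of \<open>u\<^bsup>(r)\<^esup>\<close> depends continuously on \<open>lam\<close> by an energy estimate for the difference of two
  solutions, and is unbounded by an interpolation inequality; the intermediate value theorem
  yields every value \<open>N \<ge> M\<close>.
\<close>

section \<open>Absolutely continuous functions\<close>

lemma abs_continuous_onD:
  assumes "abs_continuous_on A f" "0 < e"
  obtains d where "0 < d"
    "\<And>P T. P division_of T \<Longrightarrow> T \<subseteq> A \<Longrightarrow> (\<Sum>K\<in>P. Sup K - Inf K) < d \<Longrightarrow>
       (\<Sum>K\<in>P. \<bar>f (Sup K) - f (Inf K)\<bar>) < e"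
proof -
  from assms obtain d where "0 < d"
    "\<forall>P T. P division_of T \<and> T \<subseteq> A \<and> (\<Sum>K\<in>P. Sup K - Inf K) < d \<longrightarrow>
       (\<Sum>K\<in>P. \<bar>f (Sup K) - f (Inf K)\<bar>) < e"
    unfolding abs_continuous_on_def by blast
  then show thesis by (intro that[of d]) blast+
qed

lemma division_of_endpoints:
  fixes K :: "real set"
  assumes "P division_of T" "K \<in> P"
  shows "Inf K \<in> T" "Sup K \<in> T" "Inf K \<le> Sup K" "K = {Inf K..Sup K}"
proof -
  obtain a b where ab: "K = cbox a b" "K \<noteq> {}" "K \<subseteq> T"
    using division_ofD(2-4)[OF assms(1)] assms(2) by metis
  then have le: "a \<le> b" by auto
  then have I: "Inf K = a" "Sup K = b" using ab by auto
  show "Inf K \<le> Sup K" "K = {Inf K..Sup K}" using le I ab by auto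
  show "Inf K \<in> T" "Sup K \<in> T" using le I ab by auto
qed

lemma abs_continuous_on_imp_continuous_on:
  fixes f :: "real \<Rightarrow> real"
  assumes f: "abs_continuous_on {a..b} f"
  shows "continuous_on {a..b} f"
  unfolding continuous_on_iff
proof (intro ballI allI impI)
  fix x e :: real assume x: "x \<in> {a..b}" and "0 < e"
  obtain d where d: "0 < d"
    "\<And>P T. P division_of T \<Longrightarrow> T \<subseteq> {a..b} \<Longrightarrow> (\<Sum>K\<in>P. Sup K - Inf K) < d \<Longrightarrow>
       (\<Sum>K\<in>P. \<bar>f (Sup K) - f (Inf K)\<bar>) < e"
    by (rule abs_continuous_onD[OF f \<open>0 < e\<close>], rule that)
  have "\<bar>f v - f u\<bar> < e" if "u \<in> {a..b}" "v \<in> {a..b}" "u \<le> v" "v - u < d" for u v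
  proof -
    have "{cbox u v} division_of cbox u v"
      using that by (intro division_of_self) auto
    from d(2)[OF this] show ?thesis using that by auto
  qed
  then have "\<forall>y\<in>{a..b}. dist y x < d \<longrightarrow> dist (f y) (f x) < e"
    using x by (smt (verit) dist_real_def)
  then show "\<exists>d>0. \<forall>x'\<in>{a..b}. dist x' x < d \<longrightarrow> dist (f x') (f x) < e"
    using d(1) by blast
qed

lemma abs_continuous_on_lipschitz:
  fixes f :: "real \<Rightarrow> real"
  assumes L: "\<And>x y. x \<in> A \<Longrightarrow> y \<in> A \<Longrightarrow> \<bar>f x - f y\<bar> \<le> L * \<bar>x - y\<bar>"
  shows "abs_continuous_on A f"
  unfolding abs_continuous_on_def
proof (intro allI impI)
  fix e :: real assume e: "0 < e"
  show "\<exists>d>0. \<forall>P T. P division_of T \<and> T \<subseteq> A \<and> (\<Sum>K\<in>P. Sup K - Inf K) < d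
      \<longrightarrow> (\<Sum>K\<in>P. \<bar>f (Sup K) - f (Inf K)\<bar>) < e"
  proof (intro exI[of _ "e / (\<bar>L\<bar> + 1)"] conjI allI impI)
    show "0 < e / (\<bar>L\<bar> + 1)" using e by (simp add: add_nonneg_pos)
    fix P T assume *: "P division_of T \<and> T \<subseteq> A \<and> (\<Sum>K\<in>P. Sup K - Inf K) < e / (\<bar>L\<bar> + 1)"
    have "(\<Sum>K\<in>P. \<bar>f (Sup K) - f (Inf K)\<bar>) \<le> (\<Sum>K\<in>P. (\<bar>L\<bar> + 1) * (Sup K - Inf K))"
    proof (rule sum_mono)
      fix K assume "K \<in> P"
      note K = division_of_endpoints[OF conjunct1[OF *] this]
      have "\<bar>f (Sup K) - f (Inf K)\<bar> \<le> L * \<bar>Sup K - Inf K\<bar>"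
        using K * by (intro L) auto
      also have "\<dots> \<le> (\<bar>L\<bar> + 1) * (Sup K - Inf K)"
        using K by (intro mult_mono) auto
      finally show "\<bar>f (Sup K) - f (Inf K)\<bar> \<le> (\<bar>L\<bar> + 1) * (Sup K - Inf K)" .
    qed
    also have "\<dots> = (\<bar>L\<bar> + 1) * (\<Sum>K\<in>P. Sup K - Inf K)"
      by (simp add: sum_distrib_left)
    also have "\<dots> < e"
      using * by (auto simp: field_simps add_nonneg_pos)
    finally show "(\<Sum>K\<in>P. \<bar>f (Sup K) - f (Inf K)\<bar>) < e" .
  qed
qed

text \<open>One estimate serves sums, differences and products alike: over any division the
  increments of \<open>h\<close> are dominated by those of \<open>f\<close> and \<open>g\<close>,
  and each of these two totals is small once the total length is.\<close>

lemma abs_continuous_on_bound: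
  assumes f: "abs_continuous_on A f" and g: "abs_continuous_on A g" and B: "0 < B"
    and h: "\<And>x y. x \<in> A \<Longrightarrow> y \<in> A \<Longrightarrow> \<bar>h x - h y\<bar> \<le> B * (\<bar>f x - f y\<bar> + \<bar>g x - g y\<bar>)"
  shows "abs_continuous_on A h"
  unfolding abs_continuous_on_def
proof (intro allI impI)
  fix e :: real assume e: "0 < e"
  define e' where "e' = e / (2 * B)"
  have e': "0 < e'" using e B by (simp add: e'_def)
  obtain d1 where d1: "0 < d1"
    "\<And>P T. P division_of T \<Longrightarrow> T \<subseteq> A \<Longrightarrow> (\<Sum>K\<in>P. Sup K - Inf K) < d1 \<Longrightarrow>
       (\<Sum>K\<in>P. \<bar>f (Sup K) - f (Inf K)\<bar>) < e'"
    by (rule abs_continuous_onD[OF f e'], rule that)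
  obtain d2 where d2: "0 < d2"
    "\<And>P T. P division_of T \<Longrightarrow> T \<subseteq> A \<Longrightarrow> (\<Sum>K\<in>P. Sup K - Inf K) < d2 \<Longrightarrow>
       (\<Sum>K\<in>P. \<bar>g (Sup K) - g (Inf K)\<bar>) < e'"
    by (rule abs_continuous_onD[OF g e'], rule that)
  show "\<exists>d>0. \<forall>P T. P division_of T \<and> T \<subseteq> A \<and> (\<Sum>K\<in>P. Sup K - Inf K) < d
      \<longrightarrow> (\<Sum>K\<in>P. \<bar>h (Sup K) - h (Inf K)\<bar>) < e"
  proof (intro exI[of _ "min d1 d2"] conjI allI impI)
    show "0 < min d1 d2" using d1 d2 by simp
    fix P T assume *: "P division_of T \<and> T \<subseteq> A \<and> (\<Sum>K\<in>P. Sup K - Inf K) < min d1 d2"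
    have "(\<Sum>K\<in>P. \<bar>h (Sup K) - h (Inf K)\<bar>) \<le>
      (\<Sum>K\<in>P. B * (\<bar>f (Sup K) - f (Inf K)\<bar> + \<bar>g (Sup K) - g (Inf K)\<bar>))"
    proof (rule sum_mono)
      fix K assume "K \<in> P"
      note K = division_of_endpoints[OF conjunct1[OF *] this]
      show "\<bar>h (Sup K) - h (Inf K)\<bar> \<le> B * (\<bar>f (Sup K) - f (Inf K)\<bar> + \<bar>g (Sup K) - g (Inf K)\<bar>)"
        using K * by (intro h) auto
    qed
    also have "\<dots> = B * ((\<Sum>K\<in>P. \<bar>f (Sup K) - f (Inf K)\<bar>) + (\<Sum>K\<in>P. \<bar>g (Sup K) - g (Inf K)\<bar>))"
      by (simp add: sum_distrib_left sum.distrib distrib_left)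
    also have "\<dots> < B * (e' + e')"
      using d1(2)[of P T] d2(2)[of P T] * B by (intro mult_strict_left_mono add_strict_mono) auto
    also have "\<dots> = e" using B by (simp add: e'_def field_simps)
    finally show "(\<Sum>K\<in>P. \<bar>h (Sup K) - h (Inf K)\<bar>) < e" .
  qed
qed

lemma abs_continuous_on_const: "abs_continuous_on A (\<lambda>x. c)"
  by (rule abs_continuous_on_lipschitz[where L = 0]) auto

lemma abs_continuous_on_add:
  assumes "abs_continuous_on A f" "abs_continuous_on A g"
  shows "abs_continuous_on A (\<lambda>x. f x + g x)"
  by (rule abs_continuous_on_bound[OF assms, of 1]) auto

lemma abs_continuous_on_diff:
  assumes "abs_continuous_on A f" "abs_continuous_on A g"
  shows "abs_continuous_on A (\<lambda>x. f x - g x)"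
  by (rule abs_continuous_on_bound[OF assms, of 1]) auto

lemma abs_continuous_on_mult:
  fixes f g :: "real \<Rightarrow> real"
  assumes f: "abs_continuous_on {a..b} f" and g: "abs_continuous_on {a..b} g"
  shows "abs_continuous_on {a..b} (\<lambda>x. f x * g x)"
proof -
  have bdd: "\<exists>B>0. \<forall>x\<in>{a..b}. \<bar>h x\<bar> \<le> B" if "abs_continuous_on {a..b} h" for h :: "real \<Rightarrow> real"
  proof -
    have "bounded (h ` {a..b})"
      using abs_continuous_on_imp_continuous_on[OF that] compact_continuous_image compact_imp_bounded
      by blast
    then show ?thesis unfolding bounded_pos by auto
  qed
  obtain B1 B2 where B: "B1 > 0" "\<forall>x\<in>{a..b}. \<bar>f x\<bar> \<le> B1" "B2 > 0" "\<forall>x\<in>{a..b}. \<bar>g x\<bar> \<le> B2"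
    using bdd[OF f] bdd[OF g] by blast
  show ?thesis
  proof (rule abs_continuous_on_bound[OF f g, of "B1 + B2"])
    show "0 < B1 + B2" using B by simp
    fix x y assume xy: "x \<in> {a..b}" "y \<in> {a..b}"
    have "\<bar>f x * g x - f y * g y\<bar> = \<bar>g x * (f x - f y) + f y * (g x - g y)\<bar>"
      by (simp add: algebra_simps)
    also have "\<dots> \<le> \<bar>g x\<bar> * \<bar>f x - f y\<bar> + \<bar>f y\<bar> * \<bar>g x - g y\<bar>"
      by (metis abs_mult abs_triangle_ineq)
    also have "\<dots> \<le> (B1 + B2) * \<bar>f x - f y\<bar> + (B1 + B2) * \<bar>g x - g y\<bar>"
      using B xy by (intro add_mono mult_right_mono) (auto intro: add_increasing add_increasing2)
    finally show "\<bar>f x * g x - f y * g y\<bar> \<le> (B1 + B2) * (\<bar>f x - f y\<bar> + \<bar>g x - g y\<bar>)"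
      by (simp add: distrib_left)
  qed
qed

lemma abs_continuous_on_sum:
  assumes "\<And>i. i \<in> I \<Longrightarrow> abs_continuous_on A (f i)"
  shows "abs_continuous_on A (\<lambda>x. \<Sum>i\<in>I. f i x)"
  using assms
  by (induction I rule: infinite_finite_induct)
     (auto intro: abs_continuous_on_const abs_continuous_on_add)

text \<open>A continuous derivative is bounded on the compact interval, so the function is
  Lipschitz.\<close>

lemma abs_continuous_on_C1:
  fixes f :: "real \<Rightarrow> real"
  assumes f: "\<And>x. x \<in> {a..b} \<Longrightarrow> (f has_real_derivative f' x) (at x within {a..b})"
    and f': "continuous_on {a..b} f'"
  shows "abs_continuous_on {a..b} f"
proof -
  have "bounded (f' ` {a..b})"
    using f' compact_continuous_image compact_imp_bounded by blast
  then obtain B where B: "\<forall>x\<in>{a..b}. \<bar>f' x\<bar> \<le> B" unfolding bounded_pos by auto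
  have "\<bar>f x - f y\<bar> \<le> B * \<bar>x - y\<bar>" if "x \<in> {a..b}" "y \<in> {a..b}" for x y
    using field_differentiable_bound[of "{a..b}" f f' B x y] f B that by auto
  then show ?thesis by (rule abs_continuous_on_lipschitz)
qed

text \<open>On the exceptional set the gauge is an open set of small measure, so that absolute continuity
  bounds the contribution of the intervals tagged there.\<close>

theorem fundamental_theorem_of_calculus_abs_continuous:
  fixes f g :: "real \<Rightarrow> real"
  assumes ab: "a \<le> b" and f: "abs_continuous_on {a..b} f" and E: "negligible E"
    and d: "\<And>x. x \<in> {a..b} - E \<Longrightarrow> (f has_real_derivative g x) (at x within {a..b})"
  shows "(g has_integral (f b - f a)) {a..b}"
proof -
  \<comment> \<open>With value \<open>0\<close> on \<open>E\<close> the Riemann sum over tags in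
    \<open>E\<close> vanishes, and only the increments of \<open>f\<close> remain to be estimated
    there.\<close>
  define h where "h x = (if x \<in> E then 0 else g x)" for x
  have "(h has_integral (f b - f a)) (cbox a b)"
    unfolding has_integral
  proof (intro allI impI)
    fix e :: real assume e: "0 < e"
    \<comment> \<open>The errors at tags outside \<open>E\<close> add up to at most
      \<open>c * (b - a)\<close>, hence to at most \<open>e / 2\<close>; the \<open>1\<close> in the
      denominator covers \<open>a = b\<close>.\<close>
    define c where "c = e / (2 * (b - a + 1))"
    have c: "0 < c" using e ab by (simp add: c_def)
    have "\<exists>d>0. x \<in> {a..b} - E \<longrightarrow>
        (\<forall>y\<in>{a..b}. norm (y - x) < d \<longrightarrow> norm (f y - f x - (y - x) *\<^sub>R g x) \<le> c * norm (y - x))" for x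
    proof (cases "x \<in> {a..b} - E")
      case True
      from d[OF this] have "(f has_vector_derivative g x) (at x within {a..b})"
        by (simp add: has_real_derivative_iff_has_vector_derivative)
      then show ?thesis
        using c unfolding has_vector_derivative_def has_derivative_within_alt by blast
    qed (auto intro: exI[of _ 1])
    then obtain \<rho> where \<rho>: "\<And>x. 0 < \<rho> x" "\<And>x y. \<lbrakk>x \<in> {a..b} - E; y \<in> {a..b}; norm (y - x) < \<rho> x\<rbrakk>
        \<Longrightarrow> norm (f y - f x - (y - x) *\<^sub>R g x) \<le> c * norm (y - x)"
      by metis
    obtain \<delta> where \<delta>: "0 < \<delta>"
      "\<And>P T. P division_of T \<Longrightarrow> T \<subseteq> {a..b} \<Longrightarrow> (\<Sum>K\<in>P. Sup K - Inf K) < \<delta> \<Longrightarrow>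
         (\<Sum>K\<in>P. \<bar>f (Sup K) - f (Inf K)\<bar>) < e / 2"
      by (rule abs_continuous_onD[OF f half_gt_zero[OF e]], rule that)
    have "E \<in> sets lebesgue" using E negligible_imp_sets by blast
    from sets_lebesgue_outer_open[OF this \<delta>(1)]
    obtain G where G: "open G" "E \<subseteq> G" "G - E \<in> lmeasurable" "emeasure lebesgue (G - E) < ennreal \<delta>"
      by metis
    have GE: "(G - E) \<union> E = G" using G by auto
    have Em: "E \<in> lmeasurable" using E by (simp add: negligible_iff_measure)
    have Gm: "G \<in> lmeasurable"
      using fmeasurable.Un[OF G(3) Em] unfolding GE .
    have "emeasure lebesgue G \<le> emeasure lebesgue (G - E) + emeasure lebesgue E"
      using emeasure_subadditive[OF fmeasurableD[OF G(3)] fmeasurableD[OF Em]] unfolding GE .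
    also have "\<dots> = emeasure lebesgue (G - E)"
      using E negligible_iff_emeasure0[OF \<open>E \<in> sets lebesgue\<close>] by simp
    also have "\<dots> < ennreal \<delta>" by (fact G)
    finally have Gd: "measure lebesgue G < \<delta>"
      using Gm \<delta>(1) by (simp add: emeasure_eq_measure2 ennreal_less_iff)
    define \<gamma> where "\<gamma> x = (if x \<in> E then G else ball x (\<rho> x))" for x
    have gauge: "gauge \<gamma>"
      unfolding gauge_def \<gamma>_def using G \<rho>(1) by auto
    have bound: "norm ((\<Sum>(x, K)\<in>p. measure lborel K *\<^sub>R h x) - (f b - f a)) < e"
      if ptag: "p tagged_division_of cbox a b" and fine: "\<gamma> fine p" for p
    proof -
      have fin: "finite p" using ptag by blast
      have ba: "b - a = (\<Sum>(x,K)\<in>p. Sup K - Inf K)" "f b - f a = (\<Sum>(x,K)\<in>p. f (Sup K) - f (Inf K))"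
        using additive_tagged_division_1[where f = "\<lambda>x. x"] additive_tagged_division_1[where f = f]
              ab ptag by auto
      have pK: "x \<in> K" "K \<subseteq> {a..b}" "K \<subseteq> \<gamma> x" "Inf K \<in> K" "Sup K \<in> K" "Inf K \<le> x" "x \<le> Sup K"
          "measure lborel K = Sup K - Inf K" if xK: "(x, K) \<in> p" for x K
      proof -
        obtain u v where k: "K = cbox u v"
          using tagged_division_ofD(4)[OF ptag xK] by blast
        show "x \<in> K" "K \<subseteq> {a..b}"
          using tagged_division_ofD(2,3)[OF ptag xK] by auto
        show "K \<subseteq> \<gamma> x" using fine xK unfolding fine_def by blast
        show "Inf K \<in> K" "Sup K \<in> K" "Inf K \<le> x" "x \<le> Sup K" "measure lborel K = Sup K - Inf K"
          using k \<open>x \<in> K\<close> by auto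
      qed
      define p1 where "p1 = {xk \<in> p. fst xk \<in> E}"
      define p2 where "p2 = p - p1"
      have pp: "p1 \<subseteq> p" "p2 \<subseteq> p" "p = p1 \<union> p2" "p1 \<inter> p2 = {}" by (auto simp: p1_def p2_def)
      have sp: "(\<Sum>xk\<in>p. F xk) = (\<Sum>xk\<in>p1. F xk) + (\<Sum>xk\<in>p2. F xk)" for F :: "_ \<Rightarrow> real"
        using sum.union_disjoint[OF finite_subset[OF pp(1) fin] finite_subset[OF pp(2) fin] pp(4), of F]
        unfolding pp(3)[symmetric] .
      \<comment> \<open>Forgetting the tags merges no two intervals: an interval carrying two tags
        would have interior disjoint from itself, so it would be a single point, and both tags would
        equal that point.\<close>
      have inj: "inj_on snd p1"
      proof (rule inj_onI)
        fix y z assume yz: "y \<in> p1" "z \<in> p1" "snd y = snd z"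
        obtain x1 x2 K where e: "y = (x1, K)" "z = (x2, K)"
          using yz by (metis prod.collapse)
        have in_p: "(x1, K) \<in> p" "(x2, K) \<in> p" using yz e pp by auto
        show "y = z"
        proof (rule ccontr)
          assume "y \<noteq> z"
          then have "interior K \<inter> interior K = {}"
            using tagged_division_ofD(5)[OF ptag in_p] e by auto
          moreover obtain u v where "K = cbox u v"
            using tagged_division_ofD(4)[OF ptag in_p(1)] by blast
          ultimately have "x1 = x2"
            using pK(1)[OF in_p(1)] pK(1)[OF in_p(2)] by (auto simp: interior_cbox)
          then show False using e \<open>y \<noteq> z\<close> by simp
        qed
      qed
      have div: "(snd ` p1) division_of \<Union>(snd ` p1)"
        by (rule partial_division_of_tagged_division[OF
              tagged_partial_division_subset[OF conjunct1[OF ptag[unfolded tagged_division_of_def]] pp(1)]])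
      have sub: "\<Union>(snd ` p1) \<subseteq> G" "\<Union>(snd ` p1) \<subseteq> {a..b}"
      proof -
        have "K \<subseteq> G \<and> K \<subseteq> {a..b}" if "(x, K) \<in> p1" for x K
          using pK(2,3)[of x K] that unfolding p1_def \<gamma>_def by auto
        then have "\<forall>y\<in>p1. snd y \<subseteq> G \<and> snd y \<subseteq> {a..b}" by (metis prod.collapse)
        then show "\<Union>(snd ` p1) \<subseteq> G" "\<Union>(snd ` p1) \<subseteq> {a..b}" by blast+
      qed
      have "(\<Sum>K\<in>snd ` p1. Sup K - Inf K) = (\<Sum>K\<in>snd ` p1. measure lebesgue K)"
      proof (rule sum.cong)
        fix K assume "K \<in> snd ` p1"
        note K = division_of_endpoints(3,4)[OF div this]
        show "Sup K - Inf K = measure lebesgue K" by (subst (3) K(2)) (simp add: K(1))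
      qed simp
      also have "\<dots> = measure lebesgue (\<Union>(snd ` p1))"
        by (rule content_division[OF div])
      also have "\<dots> \<le> measure lebesgue G"
        using sub(1) Gm lmeasurable_division[OF div]
        by (intro measure_mono_fmeasurable) (auto simp: fmeasurableD)
      finally have "(\<Sum>K\<in>snd ` p1. Sup K - Inf K) < \<delta>" using Gd by simp
      from \<delta>(2)[OF div sub(2) this]
      have A1: "(\<Sum>(x,K)\<in>p1. \<bar>f (Sup K) - f (Inf K)\<bar>) < e / 2"
        by (simp add: sum.reindex[OF inj] case_prod_unfold)
      have "norm (\<Sum>(x,K)\<in>p1. measure lborel K *\<^sub>R h x - (f (Sup K) - f (Inf K))) \<le>
          (\<Sum>(x,K)\<in>p1. \<bar>f (Sup K) - f (Inf K)\<bar>)"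
        by (rule sum_norm_le) (auto simp: p1_def h_def)
      with A1 have B1: "norm (\<Sum>(x,K)\<in>p1. measure lborel K *\<^sub>R h x - (f (Sup K) - f (Inf K))) < e / 2"
        by linarith
      have "norm (\<Sum>(x,K)\<in>p2. measure lborel K *\<^sub>R h x - (f (Sup K) - f (Inf K))) \<le>
          (\<Sum>(x,K)\<in>p2. c * (Sup K - Inf K))"
      proof (rule sum_norm_le, safe)
        fix x K assume "(x, K) \<in> p2"
        then have xK: "(x, K) \<in> p" "x \<notin> E" by (auto simp: p1_def p2_def)
        define u v where "u = Inf K" and "v = Sup K"
        note K = pK[OF xK(1), folded u_def v_def]
        have uv: "u \<in> {a..b}" "v \<in> {a..b}" "u \<in> ball x (\<rho> x)" "v \<in> ball x (\<rho> x)" "x \<in> {a..b}"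
          using K(1-5) xK(2) unfolding \<gamma>_def by auto
        have "norm (f u - f x - (u - x) *\<^sub>R g x) \<le> c * norm (u - x)"
             "norm (f v - f x - (v - x) *\<^sub>R g x) \<le> c * norm (v - x)"
          using \<rho>(2)[of x u] \<rho>(2)[of x v] uv xK(2) by (auto simp: dist_real_def)
        \<comment> \<open>The tag \<open>x\<close> lies between \<open>u\<close> and
          \<open>v\<close>, so the two errors measured from \<open>x\<close> add up to a multiple of
          the full length \<open>v - u\<close>.\<close>
        moreover have "norm ((v - u) *\<^sub>R g x - (f v - f u)) =
            norm ((f u - f x - (u - x) *\<^sub>R g x) - (f v - f x - (v - x) *\<^sub>R g x))"
          by (auto simp: algebra_simps)
        moreover have "norm (u - x) + norm (v - x) = v - u" using K(6,7) by auto
        moreover have "c * norm (u - x) + c * norm (v - x) = c * (norm (u - x) + norm (v - x))"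
          by (simp only: distrib_left)
        ultimately have "norm ((v - u) *\<^sub>R g x - (f v - f u)) \<le> c * (v - u)"
          using norm_triangle_ineq4[of "f u - f x - (u - x) *\<^sub>R g x" "f v - f x - (v - x) *\<^sub>R g x"]
          by simp
        then show "norm (measure lborel K *\<^sub>R h x - (f (Sup K) - f (Inf K))) \<le> c * (Sup K - Inf K)"
          using K(8) xK(2) by (simp add: h_def u_def v_def)
      qed
      also have "\<dots> \<le> (\<Sum>(x,K)\<in>p. c * (Sup K - Inf K))"
      proof (rule sum_mono2[OF fin pp(2)])
        fix y assume "y \<in> p - p2"
        then show "0 \<le> (case y of (x, K) \<Rightarrow> c * (Sup K - Inf K))"
          using pK(6,7)[of "fst y" "snd y"] c by (auto simp: case_prod_unfold)
      qed
      also have "\<dots> = c * (b - a)"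
        unfolding ba by (simp add: sum_distrib_left case_prod_unfold)
      also have "\<dots> \<le> e / 2"
        using e ab by (simp add: c_def field_simps)
      finally have B2: "norm (\<Sum>(x,K)\<in>p2. measure lborel K *\<^sub>R h x - (f (Sup K) - f (Inf K))) \<le> e / 2" .
      have "(\<Sum>(x, K)\<in>p. measure lborel K *\<^sub>R h x) - (f b - f a) =
         (\<Sum>(x,K)\<in>p. measure lborel K *\<^sub>R h x - (f (Sup K) - f (Inf K)))"
        unfolding ba by (simp add: sum_subtractf case_prod_unfold)
      also have "\<dots> = (\<Sum>(x,K)\<in>p1. measure lborel K *\<^sub>R h x - (f (Sup K) - f (Inf K))) +
          (\<Sum>(x,K)\<in>p2. measure lborel K *\<^sub>R h x - (f (Sup K) - f (Inf K)))"
        by (rule sp)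
      finally show ?thesis using B1 B2 norm_triangle_ineq[of "\<Sum>(x,K)\<in>p1. measure lborel K *\<^sub>R h x - (f (Sup K) - f (Inf K))"
          "\<Sum>(x,K)\<in>p2. measure lborel K *\<^sub>R h x - (f (Sup K) - f (Inf K))"] by simp
    qed
    show "\<exists>\<gamma>. gauge \<gamma> \<and> (\<forall>p. p tagged_division_of cbox a b \<and> \<gamma> fine p \<longrightarrow>
        norm ((\<Sum>(x, K)\<in>p. measure lborel K *\<^sub>R h x) - (f b - f a)) < e)"
      using gauge bound by (intro exI[of _ \<gamma>]) simp
  qed
  then have "(h has_integral (f b - f a)) {a..b}" by simp
  then show ?thesis
    by (rule has_integral_spike[OF E, rotated]) (auto simp: h_def)
qed

section \<open>Square integrable functions and iterated derivatives\<close>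

lemma L2_iff: "f \<in> L2 \<longleftrightarrow>
    f \<in> borel_measurable (lebesgue_on II) \<and> integrable (lebesgue_on II) (\<lambda>x. (f x)\<^sup>2)"
  by (simp add: L2_def)

lemma L2norm_eq: "L2norm f = sqrt (LINT x|lebesgue_on II. (f x)\<^sup>2)"
  by (simp add: L2norm_def)

lemma L2norm_nonneg [simp]: "0 \<le> L2norm f"
  by (simp add: L2norm_eq integral_nonneg_AE)

lemma L2norm_power2: "(L2norm f)\<^sup>2 = (LINT x|lebesgue_on II. (f x)\<^sup>2)"
  by (simp add: L2norm_eq integral_nonneg_AE)

lemma L2norm_mult_self: "(LINT x|lebesgue_on II. f x * f x) = (L2norm f)\<^sup>2"
  by (simp add: L2norm_power2) (simp add: power2_eq_square)

lemma lebesgue_on_II_cong: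
  assumes "\<And>x. x \<in> II \<Longrightarrow> f x = g x"
  shows "(LINT x|lebesgue_on II. f x) = (LINT x|lebesgue_on II. g x)"
  by (rule Bochner_Integration.integral_cong) (use assms in auto)

lemma L2norm_cong:
  assumes "\<And>x. x \<in> II \<Longrightarrow> f x = g x"
  shows "L2norm f = L2norm g"
  unfolding L2norm_eq by (rule arg_cong[where f = sqrt], rule lebesgue_on_II_cong) (simp add: assms)

lemma continuous_on_L2:
  assumes "continuous_on II f"
  shows "f \<in> L2"
  unfolding L2_iff using assms
  by (auto intro!: continuous_imp_measurable_on_sets_lebesgue continuous_imp_integrable_real
      continuous_intros)

lemma L2_cong:
  assumes "\<And>x. x \<in> II \<Longrightarrow> f x = g x"
  shows "f \<in> L2 \<longleftrightarrow> g \<in> L2"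
proof -
  have "f \<in> borel_measurable (lebesgue_on II) \<longleftrightarrow> g \<in> borel_measurable (lebesgue_on II)"
    by (rule measurable_cong) (use assms in auto)
  moreover have "integrable (lebesgue_on II) (\<lambda>x. (f x)\<^sup>2) \<longleftrightarrow> integrable (lebesgue_on II) (\<lambda>x. (g x)\<^sup>2)"
    by (rule Bochner_Integration.integrable_cong) (use assms in auto)
  ultimately show ?thesis by (simp add: L2_iff)
qed

lemma L2_mult_integrable:
  assumes "f \<in> L2" "g \<in> L2"
  shows "integrable (lebesgue_on II) (\<lambda>x. f x * g x)"
proof (rule Bochner_Integration.integrable_bound)
  show "integrable (lebesgue_on II) (\<lambda>x. (f x)\<^sup>2 + (g x)\<^sup>2)"
    using assms by (simp add: L2_iff)
  show "(\<lambda>x. f x * g x) \<in> borel_measurable (lebesgue_on II)"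
    using assms by (auto simp: L2_iff)
  have "\<bar>a * b\<bar> \<le> a\<^sup>2 + b\<^sup>2" for a b :: real
  proof -
    have "0 \<le> \<bar>a\<bar> * \<bar>b\<bar>" by simp
    then show ?thesis using sum_squares_bound[of "\<bar>a\<bar>" "\<bar>b\<bar>"] unfolding abs_mult power2_abs by linarith
  qed
  then show "AE x in lebesgue_on II. norm (f x * g x) \<le> norm ((f x)\<^sup>2 + (g x)\<^sup>2)"
    by simp
qed

lemma L2_add:
  assumes "f \<in> L2" "g \<in> L2"
  shows "(\<lambda>x. f x + g x) \<in> L2"
  using assms L2_mult_integrable[OF assms]
  by (auto simp: L2_iff power2_sum mult.assoc)

lemma L2_cmult:
  assumes "f \<in> L2"
  shows "(\<lambda>x. c * f x) \<in> L2"
  using assms by (auto simp: L2_iff power_mult_distrib)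

lemma L2_diff:
  assumes "f \<in> L2" "g \<in> L2"
  shows "(\<lambda>x. f x - g x) \<in> L2"
  using L2_add[OF assms(1) L2_cmult[OF assms(2), of "-1"]] by simp

lemma L2norm_cmult: "L2norm (\<lambda>x. c * f x) = \<bar>c\<bar> * L2norm f"
  by (simp add: L2norm_eq power_mult_distrib real_sqrt_mult)

lemma L2norm_power2_add_cmult:
  assumes "f \<in> L2" "g \<in> L2"
  shows "(L2norm (\<lambda>x. f x + t * g x))\<^sup>2 =
    (L2norm f)\<^sup>2 + 2 * t * (LINT x|lebesgue_on II. f x * g x) + t\<^sup>2 * (L2norm g)\<^sup>2"
proof -
  have i: "integrable (lebesgue_on II) (\<lambda>x. (f x)\<^sup>2)" "integrable (lebesgue_on II) (\<lambda>x. (g x)\<^sup>2)"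
    using assms by (auto simp: L2_iff)
  have "(L2norm (\<lambda>x. f x + t * g x))\<^sup>2 =
      (LINT x|lebesgue_on II. (f x)\<^sup>2 + (2 * t) * (f x * g x) + t\<^sup>2 * (g x)\<^sup>2)"
    unfolding L2norm_power2 by (simp add: power2_sum power_mult_distrib algebra_simps)
  also have "\<dots> = (LINT x|lebesgue_on II. (f x)\<^sup>2) + (2 * t) * (LINT x|lebesgue_on II. f x * g x) +
      t\<^sup>2 * (LINT x|lebesgue_on II. (g x)\<^sup>2)"
    using i L2_mult_integrable[OF assms] by simp
  finally show ?thesis by (simp add: L2norm_power2)
qed

text \<open>The discriminant argument. It yields the Cauchy-Schwarz inequality and, with
  \<open>a = 0\<close>, the vanishing of a linear coefficient.\<close>

lemma quadratic_nonneg_imp_abs_le: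
  fixes a b c :: real
  assumes "\<And>t. 0 \<le> a\<^sup>2 + 2 * t * b + t\<^sup>2 * c\<^sup>2" "0 \<le> a" "0 \<le> c"
  shows "\<bar>b\<bar> \<le> a * c"
proof (cases "c = 0")
  case True
  have "b = 0"
  proof (rule ccontr)
    assume "b \<noteq> 0"
    \<comment> \<open>At this \<open>t\<close> the linear function takes the value
      \<open>-1\<close>.\<close>
    with assms(1)[of "- (a\<^sup>2 + 1) / (2 * b)"] True show False by (simp add: field_simps)
  qed
  then show ?thesis using True by simp
next
  case False
  have "0 \<le> a\<^sup>2 + 2 * (- b / c\<^sup>2) * b + (- b / c\<^sup>2)\<^sup>2 * c\<^sup>2" by (rule assms)
  also have "\<dots> = a\<^sup>2 - b\<^sup>2 / c\<^sup>2"
    using False by (simp add: field_simps power2_eq_square)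
  finally have "b\<^sup>2 \<le> (a * c)\<^sup>2"
    using False by (simp add: field_simps power_mult_distrib)
  then show ?thesis
    using assms by (simp add: abs_le_square_iff[symmetric] abs_mult)
qed

lemma L2_Cauchy_Schwarz:
  assumes "f \<in> L2" "g \<in> L2"
  shows "\<bar>LINT x|lebesgue_on II. f x * g x\<bar> \<le> L2norm f * L2norm g"
  by (rule quadratic_nonneg_imp_abs_le)
     (simp_all flip: L2norm_power2_add_cmult[OF assms])

lemma L2norm_triangle:
  assumes "f \<in> L2" "g \<in> L2"
  shows "L2norm (\<lambda>x. f x + g x) \<le> L2norm f + L2norm g"
proof (rule power2_le_imp_le)
  show "(L2norm (\<lambda>x. f x + g x))\<^sup>2 \<le> (L2norm f + L2norm g)\<^sup>2"
    using L2norm_power2_add_cmult[OF assms, of 1] L2_Cauchy_Schwarz[OF assms]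
    by (simp add: power2_sum)
qed simp

lemma L2norm_diff_le:
  assumes "f \<in> L2" "g \<in> L2"
  shows "\<bar>L2norm f - L2norm g\<bar> \<le> L2norm (\<lambda>x. f x - g x)"
proof -
  have "L2norm f \<le> L2norm (\<lambda>x. f x - g x) + L2norm g"
    using L2norm_triangle[OF L2_diff[OF assms] assms(2)] by simp
  moreover have "L2norm g \<le> L2norm (\<lambda>x. g x - f x) + L2norm f"
    using L2norm_triangle[OF L2_diff[OF assms(2,1)] assms(1)] by simp
  moreover have "L2norm (\<lambda>x. g x - f x) = L2norm (\<lambda>x. f x - g x)"
    by (simp add: L2norm_eq power2_commute)
  ultimately show ?thesis by linarith
qed

lemma has_integral_L2norm:
  assumes "continuous_on II f"
  shows "((\<lambda>x. (f x)\<^sup>2) has_integral (L2norm f)\<^sup>2) II"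
  unfolding L2norm_power2
  by (rule has_integral_integral_lebesgue_on)
     (use continuous_on_L2[OF assms] in \<open>auto simp: L2_iff\<close>)

lemma L2norm_eq_0:
  assumes "continuous_on II f" "L2norm f = 0" "x \<in> II"
  shows "f x = 0"
proof -
  have "(f x)\<^sup>2 = 0"
    using has_integral_L2norm[OF assms(1)] assms
    by (intro has_integral_0_cbox_imp_0[of "-1" 1 "\<lambda>x. (f x)\<^sup>2"]) (auto intro!: continuous_intros)
  then show ?thesis by simp
qed

section \<open>Iterated derivatives within \<open>II\<close> and towers of derivatives\<close>

lemma D_0 [simp]: "D 0 f = f"
  by (simp add: D_def)

lemma D_Suc: "D (Suc j) f x = vector_derivative (D j f) (at x within II)"
  by (simp add: D_def)

lemma has_derivative_imp_D_Suc:
  assumes "(D j f has_real_derivative y) (at x within II)" "x \<in> II"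
  shows "D (Suc j) f x = y"
  unfolding D_Suc using assms
  by (intro vector_derivative_within_closed_interval)
     (auto simp: has_real_derivative_iff_has_vector_derivative)

lemma differentiable_imp_has_derivative_D:
  assumes "D j f differentiable (at x within II)"
  shows "(D j f has_real_derivative D (Suc j) f x) (at x within II)"
  using assms unfolding D_Suc has_real_derivative_iff_has_vector_derivative
  by (simp add: vector_derivative_works)

lemma has_real_derivative_transform_on:
  assumes "x \<in> S" "\<And>y. y \<in> S \<Longrightarrow> g y = f y" "(f has_real_derivative d) (at x within S)"
  shows "(g has_real_derivative d) (at x within S)"
  using has_derivative_transform[OF assms(1,2)] assms(3) by (simp add: has_field_derivative_def)

text \<open>Packaging a function with its derivatives allows shifting, scaling and combining without
  \<open>D\<close>, whose values carry meaning only where derivatives exist;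
  \<open>derivative_tower_D\<close> leads back to \<open>D\<close>. Continuity of the top function
  \<open>F n\<close> is not included and is assumed separately.\<close>

definition derivative_tower :: "nat \<Rightarrow> (nat \<Rightarrow> real \<Rightarrow> real) \<Rightarrow> bool" where
  "derivative_tower n F \<longleftrightarrow>
     (\<forall>j<n. \<forall>x\<in>II. (F j has_real_derivative F (Suc j) x) (at x within II))"

lemma derivative_towerD:
  assumes "derivative_tower n F" "j < n" "x \<in> II"
  shows "(F j has_real_derivative F (Suc j) x) (at x within II)"
  using assms by (simp add: derivative_tower_def)

lemma derivative_tower_shift:
  assumes "derivative_tower n F" "m + i \<le> n"
  shows "derivative_tower m (\<lambda>j. F (i + j))"
  unfolding derivative_tower_def
proof (intro allI impI ballI)
  fix j x assume "j < m" "x \<in> II"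
  then show "(F (i + j) has_real_derivative F (i + Suc j) x) (at x within II)"
    using derivative_towerD[OF assms(1), of "i + j" x] assms(2) by simp
qed

lemma derivative_tower_le:
  assumes "derivative_tower n F" "m \<le> n"
  shows "derivative_tower m F"
  using assms by (auto simp: derivative_tower_def)

lemma derivative_tower_cmult:
  assumes "derivative_tower n F"
  shows "derivative_tower n (\<lambda>j x. c * F j x)"
  using assms unfolding derivative_tower_def by (auto intro!: DERIV_cmult)

lemma derivative_tower_diff:
  assumes "derivative_tower n F" "derivative_tower n G"
  shows "derivative_tower n (\<lambda>j x. F j x - G j x)"
  using assms unfolding derivative_tower_def by (auto intro!: DERIV_diff)

lemma derivative_tower_sum:
  assumes "\<And>i. i \<in> I \<Longrightarrow> derivative_tower n (F i)"
  shows "derivative_tower n (\<lambda>j x. \<Sum>i\<in>I. F i j x)"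
  using assms unfolding derivative_tower_def by (auto intro!: DERIV_sum)

lemma derivative_tower_continuous:
  assumes "derivative_tower n F" "j < n"
  shows "continuous_on II (F j)"
  using assms unfolding derivative_tower_def
  by (meson DERIV_isCont DERIV_continuous continuous_on_eq_continuous_within)

lemma derivative_tower_D:
  assumes F: "derivative_tower n F" and f: "\<And>x. x \<in> II \<Longrightarrow> f x = F 0 x"
  shows "j \<le> n \<Longrightarrow> x \<in> II \<Longrightarrow> D j f x = F j x"
proof (induction j arbitrary: x)
  case 0
  then show ?case using f by simp
next
  case (Suc j)
  have "(D j f has_real_derivative F (Suc j) x) (at x within II)"
    by (rule has_real_derivative_transform_on[OF _ _ derivative_towerD[OF F]])
       (use Suc in auto)
  then show ?case using Suc by (intro has_derivative_imp_D_Suc) auto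
qed

text \<open>Both \<open>F\<close> and the zero tower compute the derivatives of the zero
  function.\<close>

lemma derivative_tower_0_eq_0:
  assumes F: "derivative_tower n F" and 0: "\<And>x. x \<in> II \<Longrightarrow> F 0 x = 0" and j: "j \<le> n" "x \<in> II"
  shows "F j x = 0"
proof -
  have "derivative_tower n (\<lambda>j x. 0)" by (simp add: derivative_tower_def)
  then have "D j (\<lambda>x. 0) x = 0"
    using j by (intro derivative_tower_D[of n "\<lambda>j x. 0"]) auto
  moreover have "D j (\<lambda>x. 0) x = F j x"
    using 0 j by (intro derivative_tower_D[OF F]) auto
  ultimately show ?thesis by simp
qed

lemma L2_Sobolev_tower:
  assumes "f \<in> L2_Sobolev m"
  shows "derivative_tower (m - 1) (\<lambda>j. D j f)"
  using assms differentiable_imp_has_derivative_D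
  by (auto simp: L2_Sobolev_def derivative_tower_def)

lemma L2_Sobolev_AE_derivative:
  assumes f: "f \<in> L2_Sobolev m" and m: "1 \<le> m"
  obtains E where "negligible E"
    "\<And>x. x \<in> II - E \<Longrightarrow> (D (m - 1) f has_real_derivative D m f x) (at x within II)"
proof -
  have "AE x in lebesgue_on II. D (m - 1) f differentiable (at x within II)"
    using f by (simp add: L2_Sobolev_def)
  then have "AE x in lebesgue. x \<in> II \<longrightarrow> D (m - 1) f differentiable (at x within II)"
    by (subst (asm) AE_restrict_space_iff) auto
  then obtain E where E: "E \<in> null_sets lebesgue"
      "{x. \<not> (x \<in> II \<longrightarrow> D (m - 1) f differentiable (at x within II))} \<subseteq> E"
    by (auto simp: eventually_ae_filter)
  show thesis
  proof
    show "negligible E" using E by (simp add: negligible_iff_null_sets)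
    fix x assume "x \<in> II - E"
    then have "D (m - 1) f differentiable (at x within II)" using E by blast
    from differentiable_imp_has_derivative_D[OF this] m
    show "(D (m - 1) f has_real_derivative D m f x) (at x within II)" by simp
  qed
qed

lemma derivative_tower_L2_Sobolev:
  assumes F: "derivative_tower n F" and n: "1 \<le> n" and c: "continuous_on II (F n)"
    and f: "\<And>x. x \<in> II \<Longrightarrow> f x = F 0 x"
  shows "f \<in> L2_Sobolev n"
proof -
  note FD = derivative_tower_D[OF F f]
  have d: "(D j f has_real_derivative F (Suc j) x) (at x within II)" if "j < n" "x \<in> II" for j x
    by (rule has_real_derivative_transform_on[OF _ _ derivative_towerD[OF F]])
       (use that FD in auto)
  have "abs_continuous_on II (D (n - 1) f)"
    using d[of "n - 1"] n c by (intro abs_continuous_on_C1[where f' = "F n"]) auto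
  moreover have "D j f differentiable (at x within II)" if "j < n" "x \<in> II" for j x
    using d[OF that] real_differentiable_def by blast
  moreover have "D n f \<in> L2"
    using continuous_on_L2[OF c] L2_cong[of "D n f" "F n"] FD by auto
  ultimately show ?thesis using n by (auto simp: L2_Sobolev_def intro!: AE_I2)
qed

section \<open>Integration by parts\<close>

lemma L2_Sobolev_continuous:
  assumes f: "f \<in> L2_Sobolev m" and "j < m"
  shows "continuous_on II (D j f)"
proof (cases "j = m - 1")
  case True
  then show ?thesis
    using f abs_continuous_on_imp_continuous_on[of "-1" 1 "D j f"] by (auto simp: L2_Sobolev_def)
next
  case False
  then show ?thesis
    using derivative_tower_continuous[OF L2_Sobolev_tower[OF f], of j] assms by simp
qed

lemma abs_continuous_on_tower:
  assumes "derivative_tower n U" "j < n" "continuous_on II (U n)"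
  shows "abs_continuous_on II (U j)"
proof (rule abs_continuous_on_C1)
  show "(U j has_real_derivative U (Suc j) x) (at x within II)" if "x \<in> II" for x
    using derivative_towerD assms that by blast
  show "continuous_on II (U (Suc j))"
    using assms derivative_tower_continuous[OF assms(1), of "Suc j"]
    by (cases "Suc j = n") auto
qed

text \<open>The derivative of the alternating boundary sum telescopes, leaving only its two extreme
  terms. The top derivative of \<open>F\<close> exists only off a negligible set, so the fundamental
  theorem for absolutely continuous functions is applied to that sum.\<close>

lemma integration_by_parts_tower:
  assumes r: "1 \<le> r"
    and U: "derivative_tower r U" "continuous_on II (U r)"
    and F: "derivative_tower (r - 1) F" "abs_continuous_on II (F (r - 1))"
    and E: "negligible E"
      "\<And>x. x \<in> II - E \<Longrightarrow> (F (r - 1) has_real_derivative F r x) (at x within II)"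
  shows "((\<lambda>x. U r x * F 0 x - (-1) ^ r * (U 0 x * F r x)) has_integral
     (\<Sum>j<r. (-1) ^ j * (U (r - Suc j) 1 * F j 1)) -
     (\<Sum>j<r. (-1) ^ j * (U (r - Suc j) (-1) * F j (-1)))) II"
proof (rule fundamental_theorem_of_calculus_abs_continuous[OF _ _ E(1)])
  have "abs_continuous_on II (F j)" if "j < r" for j
  proof (cases "j = r - 1")
    case False
    then show ?thesis
      using that F abs_continuous_on_imp_continuous_on[OF F(2)]
      by (intro abs_continuous_on_tower[OF F(1)]) auto
  qed (use F in auto)
  moreover have "abs_continuous_on II (U (r - Suc j))" if "j < r" for j
    using that U by (intro abs_continuous_on_tower[OF U(1)]) auto
  ultimately show "abs_continuous_on II (\<lambda>x. \<Sum>j<r. (-1) ^ j * (U (r - Suc j) x * F j x))"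
    by (intro abs_continuous_on_sum abs_continuous_on_mult abs_continuous_on_const) auto
  fix x assume x: "x \<in> II - E"
  have dF: "(F j has_real_derivative F (Suc j) x) (at x within II)" if "j < r" for j
    using derivative_towerD[OF F(1), of j x] E(2)[OF x] x that r by (cases "j = r - 1") auto
  have dU: "(U (r - Suc j) has_real_derivative U (r - j) x) (at x within II)" if "j < r" for j
    using derivative_towerD[OF U(1), of "r - Suc j" x] x that by (simp add: Suc_diff_Suc)
  define T where "T j = (-1) ^ j * (U (r - j) x * F j x)" for j
  have "((\<lambda>x. \<Sum>j<r. (-1) ^ j * (U (r - Suc j) x * F j x)) has_real_derivative
      (\<Sum>j<r. (-1) ^ j * (U (r - j) x * F j x + F (Suc j) x * U (r - Suc j) x))) (at x within II)"
    by (intro DERIV_sum DERIV_cmult DERIV_mult dF dU) auto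
  also have "(\<Sum>j<r. (-1) ^ j * (U (r - j) x * F j x + F (Suc j) x * U (r - Suc j) x)) =
      (\<Sum>j<r. T j - T (Suc j))"
    by (intro sum.cong refl) (simp add: T_def algebra_simps)
  also have "\<dots> = T 0 - T r" by (rule sum_lessThan_telescope')
  finally show "((\<lambda>x. \<Sum>j<r. (-1) ^ j * (U (r - Suc j) x * F j x)) has_real_derivative
      U r x * F 0 x - (-1) ^ r * (U 0 x * F r x)) (at x within II)"
    by (simp add: T_def)
qed auto

lemma neg_one_powi_diff_one: "(-1 :: real) powi (int k - 1) = - ((-1) ^ k)"
  by (simp add: power_int_diff)

text \<open>The data at \<open>1\<close> remove the upper boundary sum, and the data at
  \<open>-1\<close> leave only the term \<open>j = k\<close> of the lower one. The sign
  \<open>(-1) powi (int k - 1)\<close> turns this term into \<open>- F k (-1)\<close>, which is then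
  subtracted.\<close>

lemma boundary_functional:
  assumes r: "1 \<le> r" "k < r"
    and U: "derivative_tower r U" "continuous_on II (U r)"
      "\<And>s. s < r \<Longrightarrow> U s (-1) = (-1) powi (int k - 1) * (if s = r - k - 1 then 1 else 0)"
      "\<And>s. s < r \<Longrightarrow> U s 1 = 0"
    and F: "derivative_tower (r - 1) F" "abs_continuous_on II (F (r - 1))"
    and E: "negligible E"
      "\<And>x. x \<in> II - E \<Longrightarrow> (F (r - 1) has_real_derivative F r x) (at x within II)"
  shows "((\<lambda>x. U r x * F 0 x - (-1) ^ r * (U 0 x * F r x)) has_integral F k (-1)) II"
proof -
  have "(\<Sum>j<r. (-1) ^ j * (U (r - Suc j) 1 * F j 1)) = 0"
    using U(4) by (intro sum.neutral) auto
  moreover have "(\<Sum>j<r. (-1) ^ j * (U (r - Suc j) (-1) * F j (-1))) =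
      (\<Sum>j<r. if j = k then - F k (-1) else 0)"
  proof (rule sum.cong)
    fix j assume j: "j \<in> {..<r}"
    have "r - Suc j = r - k - 1 \<longleftrightarrow> j = k" using j r by auto
    then have "U (r - Suc j) (-1) = (if j = k then - ((-1) ^ k) else 0)"
      using U(3)[of "r - Suc j"] j by (auto simp: neg_one_powi_diff_one)
    then show "(-1) ^ j * (U (r - Suc j) (-1) * F j (-1)) = (if j = k then - F k (-1) else 0)"
      by (simp add: mult.assoc[symmetric] power_mult_distrib[symmetric])
  qed simp
  moreover have "\<dots> = - F k (-1)" using r by simp
  ultimately show ?thesis
    using integration_by_parts_tower[OF r(1) U(1,2) F E] by simp
qed

lemma boundary_functional_Sobolev:
  assumes r: "1 \<le> r" "k < r"
    and U: "derivative_tower r U" "continuous_on II (U r)"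
      "\<And>s. s < r \<Longrightarrow> U s (-1) = (-1) powi (int k - 1) * (if s = r - k - 1 then 1 else 0)"
      "\<And>s. s < r \<Longrightarrow> U s 1 = 0"
    and f: "f \<in> L2_Sobolev r"
  shows "D k f (-1) = (LINT x|lebesgue_on II. U r x * f x) -
     (-1) ^ r * (LINT x|lebesgue_on II. U 0 x * D r f x)"
proof -
  obtain E where E: "negligible E"
      "\<And>x. x \<in> II - E \<Longrightarrow> (D (r - 1) f has_real_derivative D r f x) (at x within II)"
    using L2_Sobolev_AE_derivative[OF f r(1)] by blast
  have "abs_continuous_on II (D (r - 1) f)" using f by (simp add: L2_Sobolev_def)
  note * = boundary_functional[OF r U L2_Sobolev_tower[OF f] this E, simplified]
  have "f \<in> L2" "D r f \<in> L2" "U r \<in> L2" "U 0 \<in> L2"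
    using L2_Sobolev_continuous[OF f, of 0] f r U(2) derivative_tower_continuous[OF U(1), of 0]
    by (auto intro!: continuous_on_L2 simp: L2_Sobolev_def)
  then have i: "integrable (lebesgue_on II) (\<lambda>x. U r x * f x)"
      "integrable (lebesgue_on II) (\<lambda>x. U 0 x * D r f x)"
    by (auto intro!: L2_mult_integrable)
  have "((\<lambda>x. U r x * f x - (-1) ^ r * (U 0 x * D r f x)) has_integral
     (LINT x|lebesgue_on II. U r x * f x) - (-1) ^ r * (LINT x|lebesgue_on II. U 0 x * D r f x)) II"
    by (intro has_integral_diff has_integral_mult_right has_integral_integral_lebesgue_on i) auto
  with * show ?thesis by (rule has_integral_unique)
qed

text \<open>Downward induction on the order: a function with zero derivative is constant, and its
  value at \<open>1\<close> makes the constant zero.\<close>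

lemma derivative_tower_eq_0:
  assumes "derivative_tower n U" "\<And>s. s < n \<Longrightarrow> U s 1 = 0" "\<And>x. x \<in> II \<Longrightarrow> U n x = 0"
    "x \<in> II" "s \<le> n"
  shows "U s x = 0"
  using assms(5,4)
proof (induction s arbitrary: x rule: inc_induct)
  case base
  then show ?case using assms(3) by simp
next
  case (step s)
  have "(U s has_field_derivative 0) (at y within II)" if "y \<in> II" for y
    using derivative_towerD[OF assms(1) step(2) that] step(3)[OF that] by simp
  then obtain c where "\<And>y. y \<in> II \<Longrightarrow> U s y = c"
    using has_field_derivative_zero_constant[of II "U s"] by auto
  then show ?case
    using assms(2)[OF step(2)] step.prems by force
qed

text \<open>Testing the equation against the solution itself gives
  \<open>\<integral> (U r)\<^sup>2 + lam * (U 0)\<^sup>2 = 0\<close>.\<close>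

lemma homogeneous_bvp_zero:
  assumes r: "1 \<le> r" and lam: "0 \<le> lam"
    and U: "derivative_tower (2 * r - 1) U" "abs_continuous_on II (U (2 * r - 1))"
    and E: "negligible E"
      "\<And>x. x \<in> II - E \<Longrightarrow> (U (2 * r - 1) has_real_derivative U (2 * r) x) (at x within II)"
    and ode: "\<And>x. x \<in> II - E \<Longrightarrow> (-1) ^ r * U (2 * r) x + lam * U 0 x = 0"
    and bc: "\<And>s. s < r \<Longrightarrow> U s (-1) = 0" "\<And>s. s < r \<Longrightarrow> U s 1 = 0"
    and s: "s \<le> r" and x: "x \<in> II"
  shows "U s x = 0"
proof -
  have cont: "continuous_on II (U j)" if "j < 2 * r" for j
    using that derivative_tower_continuous[OF U(1), of j] abs_continuous_on_imp_continuous_on[OF U(2)]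
    by (cases "j = 2 * r - 1") auto
  have U1: "derivative_tower r U" using derivative_tower_le[OF U(1)] r by simp
  have U2: "derivative_tower (r - 1) (\<lambda>j. U (r + j))"
    using derivative_tower_shift[OF U(1), of "r - 1" r] r by simp
  have eq: "r + (r - 1) = 2 * r - 1" "r + r = 2 * r" using r by auto
  have cr: "continuous_on II (U r)" using cont[of r] r by simp
  \<comment> \<open>The upper half of the tower plays the role of \<open>F\<close>. Every boundary
    product contains some \<open>U s\<close> with \<open>s < r\<close>, so all of them
    vanish.\<close>
  have "((\<lambda>x. U r x * U r x - (-1) ^ r * (U 0 x * U (2 * r) x)) has_integral 0) II"
    using integration_by_parts_tower[OF r U1 cr U2, of E] U(2) E bc
    unfolding eq by (simp add: sum.neutral)
  then have "((\<lambda>x. (U r x)\<^sup>2 + lam * (U 0 x)\<^sup>2) has_integral 0) II"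
  proof (rule has_integral_spike[OF E(1), rotated])
    fix x assume "x \<in> II - E"
    then have "(-1) ^ r * U (2 * r) x = - (lam * U 0 x)" using ode by fastforce
    then have "(-1) ^ r * (U 0 x * U (2 * r) x) = - (lam * U 0 x) * U 0 x"
      by (metis mult.commute mult.left_commute)
    then show "(U r x)\<^sup>2 + lam * (U 0 x)\<^sup>2 = U r x * U r x - (-1) ^ r * (U 0 x * U (2 * r) x)"
      by (simp add: power2_eq_square)
  qed
  \<comment> \<open>A continuous nonnegative function with zero integral vanishes pointwise. Only
    \<open>U r = 0\<close> is extracted from it, which is available for \<open>lam = 0\<close> as
    well.\<close>
  then have "(U r y)\<^sup>2 + lam * (U 0 y)\<^sup>2 = 0" if "y \<in> II" for y
    using that lam cr cont[of 0] r
    by (intro has_integral_0_cbox_imp_0[of "-1" 1 "\<lambda>x. (U r x)\<^sup>2 + lam * (U 0 x)\<^sup>2"])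
       (auto intro!: continuous_intros)
  then have "U r y = 0" if "y \<in> II" for y
    using that lam by (metis add_nonneg_eq_0_iff mult_nonneg_nonneg zero_le_power2 power_eq_0_iff)
  from derivative_tower_eq_0[OF U1 bc(2) this x s] show ?thesis .
qed

lemma bvp_solution_unique:
  assumes r: "1 \<le> r" and lam: "0 \<le> lam"
    and u: "bvp_solution r k lam u" and v: "bvp_solution r k lam v" and x: "x \<in> II"
  shows "u x = v x"
proof -
  have us: "u \<in> L2_Sobolev (2 * r)" and vs: "v \<in> L2_Sobolev (2 * r)"
    using u v by (auto simp: bvp_solution_def)
  have r2: "1 \<le> 2 * r" using r by simp
  obtain E where E: "negligible E"
      "\<And>x. x \<in> II - E \<Longrightarrow> (D (2 * r - 1) u has_real_derivative D (2 * r) u x) (at x within II)"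
    using L2_Sobolev_AE_derivative[OF us r2] by blast
  obtain E' where E': "negligible E'"
      "\<And>x. x \<in> II - E' \<Longrightarrow> (D (2 * r - 1) v has_real_derivative D (2 * r) v x) (at x within II)"
    using L2_Sobolev_AE_derivative[OF vs r2] by blast
  define U where "U j x = D j u x - D j v x" for j x
  \<comment> \<open>The differential equation is posed on the open interval, so the endpoints join
    the exceptional set.\<close>
  define N where "N = E \<union> E' \<union> {-1, 1}"
  have "U 0 x = 0"
  proof (rule homogeneous_bvp_zero[OF r lam, of U N])
    show "derivative_tower (2 * r - 1) U"
      using derivative_tower_diff[OF L2_Sobolev_tower[OF us] L2_Sobolev_tower[OF vs]]
      unfolding U_def .
    show "abs_continuous_on II (U (2 * r - 1))"
      unfolding U_def using us vs by (intro abs_continuous_on_diff) (auto simp: L2_Sobolev_def)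
    show "negligible N" using E(1) E'(1) by (auto simp: N_def)
    fix y assume y: "y \<in> II - N"
    then show "(U (2 * r - 1) has_real_derivative U (2 * r) y) (at y within II)"
      unfolding U_def by (intro DERIV_diff E E') (auto simp: N_def)
    have "y \<in> {-1<..<1}" using y by (auto simp: N_def)
    then have "(-1) ^ r * D (2 * r) u y + lam * u y = 0" "(-1) ^ r * D (2 * r) v y + lam * v y = 0"
      using u v unfolding bvp_solution_def by blast+
    then show "(-1) ^ r * U (2 * r) y + lam * U 0 y = 0"
      unfolding U_def by (simp add: algebra_simps)
  next
    fix s assume "s < r"
    then show "U s (-1) = 0" "U s 1 = 0"
      using u v unfolding bvp_solution_def U_def by auto
  qed (use x r in auto)
  then show ?thesis by (simp add: U_def)
qed

section \<open>The boundary value problem\<close>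

text \<open>For a square system, a trivial kernel means a nonzero determinant and hence an inverse
  matrix. This turns uniqueness for the boundary value problem into existence.\<close>

lemma injective_linear_system_solvable:
  fixes A :: "nat \<Rightarrow> nat \<Rightarrow> real" and b :: "nat \<Rightarrow> real"
  assumes inj: "\<And>x j. (\<And>i. i < n \<Longrightarrow> (\<Sum>j<n. A i j * x j) = 0) \<Longrightarrow> j < n \<Longrightarrow> x j = 0"
  shows "\<exists>x. \<forall>i<n. (\<Sum>j<n. A i j * x j) = b i"
proof -
  define M where "M = mat n n (\<lambda>(i, j). A i j)"
  have M: "M \<in> carrier_mat n n" by (simp add: M_def)
  have Mv: "vec_index (M *\<^sub>v v) i = (\<Sum>j<n. A i j * vec_index v j)"
    if "v \<in> carrier_vec n" "i < n" for v i
    using that by (auto simp: M_def scalar_prod_def lessThan_atLeast0 intro!: sum.cong)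
  have "Determinant.det M \<noteq> 0"
  proof
    assume "Determinant.det M = 0"
    then obtain v where v: "v \<in> carrier_vec n" "v \<noteq> 0\<^sub>v n" "M *\<^sub>v v = 0\<^sub>v n"
      using det_0_iff_vec_prod_zero_field[OF M] by blast
    have "vec_index v j = 0" if "j < n" for j
      by (rule inj[of "vec_index v"]) (use Mv[OF v(1)] v(3) that in auto)
    then have "v = 0\<^sub>v n" using v(1) by (intro eq_vecI) auto
    with v(2) show False by simp
  qed
  from det_non_zero_imp_unit[OF M this, of undefined]
  obtain B where B: "B \<in> carrier_mat n n" "M * B = 1\<^sub>m n"
    by (auto simp: Units_def ring_mat_simps)
  define x where "x = B *\<^sub>v vec n b"
  have x: "x \<in> carrier_vec n" using B(1) by (simp add: x_def)
  have "M *\<^sub>v x = vec n b"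
    using B M by (simp add: x_def assoc_mult_mat_vec[symmetric, of M n n B n])
  then have "(\<Sum>j<n. A i j * vec_index x j) = b i" if "i < n" for i
    using Mv[OF x that] that by simp
  then show ?thesis by blast
qed

text \<open>The power series with coefficients \<open>entire_coeff p c m\<close> is
  \<open>\<Sum>n. c ^ n * x ^ (p * n + m) / fact (p * n + m)\<close>. For \<open>m < p\<close> these series, in the variable \<open>x - 1\<close>, are the
  solutions of \<open>y\<^bsup>(p)\<^esup> = c * y\<close> whose derivatives of order less than \<open>p\<close> at \<open>1\<close> are those of
  \<open>(x - 1) ^ m / fact m\<close>; differentiation lowers \<open>m\<close>.\<close>

definition entire_coeff :: "nat \<Rightarrow> real \<Rightarrow> nat \<Rightarrow> nat \<Rightarrow> real" where
  "entire_coeff p c m i = (if m \<le> i \<and> p dvd (i - m) then c ^ ((i - m) div p) / fact i else 0)"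

definition entire_sol :: "nat \<Rightarrow> real \<Rightarrow> nat \<Rightarrow> real \<Rightarrow> real" where
  "entire_sol p c m x = (\<Sum>i. entire_coeff p c m i * (x - 1) ^ i)"

lemma summable_entire_coeff: "summable (\<lambda>i. entire_coeff p c m i * y ^ i)"
proof (rule summable_comparison_test')
  \<comment> \<open>As \<open>C\<close> is at least \<open>1\<close>, the exponent
    \<open>(i - m) div p\<close> can be raised to \<open>i\<close>, and the exponential series
    dominates.\<close>
  define C where "C = max 1 \<bar>c\<bar>"
  show "summable (\<lambda>i. (C * \<bar>y\<bar>) ^ i / fact i)"
    using summable_exp[of "C * \<bar>y\<bar>"] by (simp add: field_simps)
  fix i :: nat
  have "\<bar>c\<bar> ^ ((i - m) div p) \<le> C ^ ((i - m) div p)"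
    by (rule power_mono) (auto simp: C_def)
  also have "\<dots> \<le> C ^ i"
    by (rule power_increasing) (auto simp: C_def intro: order_trans[OF div_le_dividend])
  finally have "\<bar>entire_coeff p c m i\<bar> \<le> C ^ i / fact i"
    by (auto simp: entire_coeff_def C_def power_abs divide_right_mono)
  then have "\<bar>entire_coeff p c m i\<bar> * \<bar>y\<bar> ^ i \<le> C ^ i / fact i * \<bar>y\<bar> ^ i"
    by (rule mult_right_mono) simp
  then show "norm (entire_coeff p c m i * y ^ i) \<le> (C * \<bar>y\<bar>) ^ i / fact i"
    by (simp add: abs_mult power_abs power_mult_distrib)
qed

lemma diffs_entire_coeff_Suc: "diffs (entire_coeff p c (Suc m)) = entire_coeff p c m"
  by (rule ext) (simp add: diffs_def entire_coeff_def field_simps del: of_nat_Suc)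

text \<open>The constant term disappears, and each remaining exponent \<open>p * q\<close> becomes
  \<open>(p - 1) + p * (q - 1)\<close>, which frees one factor \<open>c\<close>.\<close>

lemma diffs_entire_coeff_0:
  assumes "1 \<le> p"
  shows "diffs (entire_coeff p c 0) = (\<lambda>n. c * entire_coeff p c (p - 1) n)"
proof (rule ext)
  fix n
  show "diffs (entire_coeff p c 0) n = c * entire_coeff p c (p - 1) n"
  proof (cases "p dvd Suc n")
    case True
    then obtain q where q: "Suc n = p * q" by (auto elim: dvdE)
    then obtain q' where q': "q = Suc q'" by (cases q) auto
    have n: "n - (p - 1) = p * q'" "p - 1 \<le> n" using q q' assms by auto
    have "Suc n div p = Suc q'" using q q' assms by simp
    then show ?thesis
      using n True assms by (simp add: diffs_def entire_coeff_def field_simps del: of_nat_Suc)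
  next
    case False
    have "\<not> (p - 1 \<le> n \<and> p dvd n - (p - 1))"
    proof
      assume *: "p - 1 \<le> n \<and> p dvd n - (p - 1)"
      then have "Suc n = (n - (p - 1)) + p" using assms by auto
      then show False using * False by (metis dvd_add dvd_refl)
    qed
    then show ?thesis using False by (auto simp: diffs_def entire_coeff_def)
  qed
qed

lemma entire_sol_derivative:
  "(entire_sol p c m has_real_derivative (\<Sum>i. diffs (entire_coeff p c m) i * (x - 1) ^ i)) (at x)"
proof -
  have "((\<lambda>y. \<Sum>i. entire_coeff p c m i * y ^ i) has_real_derivative
      (\<Sum>i. diffs (entire_coeff p c m) i * (x - 1) ^ i)) (at (x - 1))"
    by (rule termdiffs_strong_converges_everywhere) (rule summable_entire_coeff)
  then have "((\<lambda>x. \<Sum>i. entire_coeff p c m i * (x - 1) ^ i) has_real_derivative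
      (\<Sum>i. diffs (entire_coeff p c m) i * (x - 1) ^ i) * 1) (at x)"
    by (rule DERIV_chain2) (auto intro!: derivative_eq_intros)
  then show ?thesis by (simp add: entire_sol_def[abs_def])
qed

lemma entire_sol_Suc_derivative:
  "(entire_sol p c (Suc m) has_real_derivative entire_sol p c m x) (at x)"
  using entire_sol_derivative[of p c "Suc m" x] by (simp add: diffs_entire_coeff_Suc entire_sol_def)

lemma entire_sol_0_derivative:
  assumes "1 \<le> p"
  shows "(entire_sol p c 0 has_real_derivative c * entire_sol p c (p - 1) x) (at x)"
  using entire_sol_derivative[of p c 0 x] summable_entire_coeff[of p c "p - 1" "x - 1"]
  by (simp add: diffs_entire_coeff_0[OF assms] entire_sol_def suminf_mult mult.assoc)

lemma entire_sol_at_1: "entire_sol p c m 1 = (if m = 0 then 1 else 0)"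
  using powser_zero[of "entire_coeff p c m"] by (simp add: entire_sol_def entire_coeff_def)

text \<open>Since \<open>0 ^ 0 = 1\<close>, exactly the leading term survives. This is what makes
  the solution for \<open>lam = 0\<close> polynomial.\<close>

lemma entire_sol_c_0:
  assumes "1 \<le> p"
  shows "entire_sol p 0 m x = (x - 1) ^ m / fact m"
proof -
  have "entire_coeff p 0 m i = 0" if "i \<noteq> m" for i
  proof (cases "m \<le> i \<and> p dvd i - m")
    case True
    then obtain q where "i - m = p * q" by (auto elim: dvdE)
    moreover have "i - m \<noteq> 0" using True that by auto
    ultimately have "(i - m) div p \<noteq> 0" using assms by auto
    then show ?thesis by (simp add: entire_coeff_def zero_power)
  qed (auto simp: entire_coeff_def)
  then have "entire_sol p 0 m x = (\<Sum>i\<in>{m}. entire_coeff p 0 m i * (x - 1) ^ i)"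
    unfolding entire_sol_def by (intro suminf_finite) auto
  then show ?thesis by (simp add: entire_coeff_def)
qed

text \<open>The derivative of order \<open>s\<close> of \<open>entire_sol p c m\<close>: once
  \<open>s\<close> exceeds \<open>m\<close>, the index wraps around by \<open>p\<close> and a factor
  \<open>c\<close> appears. A single wrap is recorded, which suffices up to order
  \<open>m + p\<close>.\<close>

definition entire_tower :: "nat \<Rightarrow> real \<Rightarrow> nat \<Rightarrow> nat \<Rightarrow> real \<Rightarrow> real" where
  "entire_tower p c m s x =
     (if s \<le> m then entire_sol p c (m - s) x else c * entire_sol p c (m + p - s) x)"

lemma entire_tower_derivative:
  assumes "1 \<le> p" "s < m + p"
  shows "(entire_tower p c m s has_real_derivative entire_tower p c m (Suc s) x) (at x)"
proof -
  consider "s < m" | "s = m" | "m < s" by linarith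
  then show ?thesis
  proof cases
    case 1
    then have "m - s = Suc (m - Suc s)" by simp
    then show ?thesis
      using 1 entire_sol_Suc_derivative[of p c "m - Suc s" x]
      by (simp add: entire_tower_def[abs_def])
  next
    case 2
    then show ?thesis
      using entire_sol_0_derivative[OF assms(1), of c x] by (simp add: entire_tower_def[abs_def])
  next
    case 3
    then have "m + p - s = Suc (m + p - Suc s)" using assms by simp
    then show ?thesis
      using 3 entire_sol_Suc_derivative[of p c "m + p - Suc s" x, THEN DERIV_cmult, of c]
      by (simp add: entire_tower_def[abs_def])
  qed
qed

text \<open>The solution of the boundary value problem is \<open>V r\<close>; the tower starts with an \<open>r\<close>-fold
  antiderivative of it, which is an extremal function.\<close>

definition bvp_tower :: "nat \<Rightarrow> nat \<Rightarrow> real \<Rightarrow> (nat \<Rightarrow> real \<Rightarrow> real) \<Rightarrow> bool" where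
  "bvp_tower r k lam V \<longleftrightarrow> derivative_tower (3 * r) V
     \<and> (\<forall>x. V (3 * r) x = - ((-1) ^ r * lam) * V r x)
     \<and> (\<forall>s<r. V (r + s) (-1) = (-1) powi (int k - 1) * (if s = r - k - 1 then 1 else 0))
     \<and> (\<forall>s<r. V (r + s) 1 = 0)
     \<and> (lam = 0 \<longrightarrow> (\<exists>Q. degree Q \<le> r - 1 \<and> (\<forall>x. V (2 * r) x = poly Q x)))"

lemma bvp_tower_exists:
  assumes r: "1 \<le> r" and lam: "0 \<le> lam"
  shows "\<exists>V. bvp_tower r k lam V"
proof -
  define c where "c = - ((-1) ^ r * lam)"
  \<comment> \<open>Starting at index \<open>2 * r + j\<close> builds the zero data at
    \<open>1\<close> for the orders from \<open>r\<close> to \<open>2 * r - 1\<close> into every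
    combination. The \<open>r\<close> coefficients, which are the values at \<open>1\<close> of the
    next \<open>r\<close> derivatives, remain for the \<open>r\<close> conditions at
    \<open>-1\<close>.\<close>
  define V where "V b s x = (\<Sum>j<r. b j * entire_tower (2 * r) c (2 * r + j) s x)" for b s x
  have "derivative_tower (3 * r) (entire_tower (2 * r) c (2 * r + j))" for j
    unfolding derivative_tower_def
    by (intro allI impI ballI, rule has_field_derivative_at_within[OF entire_tower_derivative])
       (use r in auto)
  then have V_tower: "derivative_tower (3 * r) (V b)" for b
    unfolding V_def[abs_def] by (intro derivative_tower_sum derivative_tower_cmult)
  have V_ode: "V b (3 * r) x = c * V b r x" for b x
    unfolding V_def sum_distrib_left
    by (intro sum.cong refl) (auto simp: entire_tower_def)
  have V_1: "V b (r + s) 1 = 0" if "s < r" for b s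
    unfolding V_def using that by (intro sum.neutral) (auto simp: entire_tower_def entire_sol_at_1)
  have V_coeff: "V b (2 * r + i) 1 = b i" if "i < r" for b i
  proof -
    have "V b (2 * r + i) 1 = (\<Sum>j<r. if j = i then b i else 0)"
      unfolding V_def using that
      by (intro sum.cong refl) (auto simp: entire_tower_def entire_sol_at_1)
    then show ?thesis using that by simp
  qed
  have eq: "r + (2 * r - 1) = 3 * r - 1" "r + 2 * r = 3 * r" using r by auto
  \<comment> \<open>The energy argument kills the solution of the homogeneous problem, so
    \<open>V b (2 * r)\<close> and its derivatives vanish; their values at \<open>1\<close> are the
    coefficients.\<close>
  have inj: "b j = 0" if b: "\<And>s. s < r \<Longrightarrow> V b (r + s) (-1) = 0" and j: "j < r" for b j
  proof -
    have zero: "V b (2 * r) x = 0" if "x \<in> II" for x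
    proof -
      have "(\<lambda>s. V b (r + s)) r x = 0"
      proof (rule homogeneous_bvp_zero[OF r lam, of "\<lambda>s. V b (r + s)" "{}"])
        have t: "derivative_tower (2 * r) (\<lambda>s. V b (r + s))"
          by (rule derivative_tower_shift[OF V_tower]) simp
        then show "derivative_tower (2 * r - 1) (\<lambda>s. V b (r + s))"
          by (rule derivative_tower_le) simp
        show "(V b (r + (2 * r - 1)) has_real_derivative V b (r + 2 * r) y) (at y within II)"
          if "y \<in> II - {}" for y
          using derivative_towerD[OF t, of "2 * r - 1" y] that r by simp
        have "continuous_on II (V b (r + 2 * r))"
          using derivative_tower_continuous[OF V_tower, of r b] r
          unfolding eq V_ode by (intro continuous_intros) auto
        then show "abs_continuous_on II (V b (r + (2 * r - 1)))"
          using r by (intro abs_continuous_on_tower[OF t]) auto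
        show "(-1) ^ r * V b (r + 2 * r) y + lam * V b (r + 0) y = 0" for y
          unfolding eq V_ode c_def by (simp add: algebra_simps flip: power_mult_distrib)
      qed (use b V_1 that in auto)
      then show ?thesis by (simp add: mult_2)
    qed
    have t: "derivative_tower r (\<lambda>s. V b (2 * r + s))"
      by (rule derivative_tower_shift[OF V_tower]) simp
    have "V b (2 * r + j) 1 = 0"
      by (rule derivative_tower_0_eq_0[OF t]) (use zero j in auto)
    then show ?thesis using V_coeff[OF j] by simp
  qed
  have "\<exists>b. \<forall>s<r. (\<Sum>j<r. entire_tower (2 * r) c (2 * r + j) (r + s) (-1) * b j) =
      (-1) powi (int k - 1) * (if s = r - k - 1 then 1 else 0)"
    by (rule injective_linear_system_solvable, rule inj) (auto simp: V_def mult.commute)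
  then obtain b where b: "\<And>s. s < r \<Longrightarrow>
      V b (r + s) (-1) = (-1) powi (int k - 1) * (if s = r - k - 1 then 1 else 0)"
    by (auto simp: V_def mult.commute)
  have "\<exists>Q. degree Q \<le> r - 1 \<and> (\<forall>x. V b (2 * r) x = poly Q x)" if "lam = 0"
  proof (intro exI conjI allI)
    \<comment> \<open>For \<open>c = 0\<close> the basis functions at level \<open>2 * r\<close> are
      \<open>(x - 1) ^ j / fact j\<close>.\<close>
    let ?Q = "\<Sum>j<r. Polynomial.smult (b j / fact j) ([:-1, 1:] ^ j)"
    show "degree ?Q \<le> r - 1"
    proof (rule degree_sum_le)
      fix j assume "j \<in> {..<r}"
      then show "degree (Polynomial.smult (b j / fact j) ([:-1, 1:] ^ j)) \<le> r - 1"
        using order_trans[OF degree_smult_le, of "[:-1, 1:] ^ j" "r - 1"]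
        by (auto simp: degree_linear_power)
    qed simp
    show "V b (2 * r) x = poly ?Q x" for x
      using r that unfolding V_def poly_sum
      by (intro sum.cong refl) (auto simp: c_def entire_tower_def entire_sol_c_0 algebra_simps)
  qed
  then have "bvp_tower r k lam (V b)"
    unfolding bvp_tower_def using V_tower V_ode b V_1 c_def by blast
  then show ?thesis by blast
qed

lemma bvp_towerD:
  assumes "bvp_tower r k lam V"
  shows "derivative_tower (3 * r) V" "V (3 * r) x = - ((-1) ^ r * lam) * V r x"
    "s < r \<Longrightarrow> V (r + s) (-1) = (-1) powi (int k - 1) * (if s = r - k - 1 then 1 else 0)"
    "s < r \<Longrightarrow> V (r + s) 1 = 0"
    "lam = 0 \<Longrightarrow> \<exists>Q. degree Q \<le> r - 1 \<and> (\<forall>x. V (2 * r) x = poly Q x)"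
  using assms by (auto simp: bvp_tower_def)

lemma bvp_tower_continuous:
  assumes V: "bvp_tower r k lam V" and r: "1 \<le> r" and s: "s \<le> 3 * r"
  shows "continuous_on II (V s)"
proof (cases "s = 3 * r")
  case True
  have "V (3 * r) = (\<lambda>x. - ((-1) ^ r * lam) * V r x)"
    using bvp_towerD(2)[OF V] by blast
  then show ?thesis
    unfolding True using derivative_tower_continuous[OF bvp_towerD(1)[OF V], of r] r
    by (auto intro!: continuous_intros)
next
  case False
  then show ?thesis using derivative_tower_continuous[OF bvp_towerD(1)[OF V], of s] s by simp
qed

text \<open>Resolves the \<open>THE\<close> in \<open>u_sol\<close>: \<open>V r\<close>, cut off to
  zero outside \<open>II\<close>, solves the problem, and uniqueness on \<open>II\<close> excludes
  any other candidate.\<close>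

lemma D_u_sol:
  assumes V: "bvp_tower r k lam V" and r: "1 \<le> r" and lam: "0 \<le> lam"
    and j: "j \<le> 2 * r" and x: "x \<in> II"
  shows "D j (u_sol r k lam) x = V (r + j) x"
proof -
  define u where "u x = (if x \<in> II then V r x else 0)" for x
  have t: "derivative_tower (2 * r) (\<lambda>s. V (r + s))"
    by (rule derivative_tower_shift[OF bvp_towerD(1)[OF V]]) simp
  have Du: "D j u x = V (r + j) x" if "j \<le> 2 * r" "x \<in> II" for j x
    by (rule derivative_tower_D[OF t]) (use that in \<open>auto simp: u_def\<close>)
  have "u \<in> L2_Sobolev (2 * r)"
    by (rule derivative_tower_L2_Sobolev[OF t])
       (use r bvp_tower_continuous[OF V r] in \<open>auto simp: u_def\<close>)
  moreover have "(-1) ^ r * D (2 * r) u x + lam * u x = 0" if "x \<in> {-1<..<1}" for x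
  proof -
    have "D (2 * r) u x = - ((-1) ^ r * lam) * u x"
      using Du[of "2 * r" x] bvp_towerD(2)[OF V, of x] that by (simp add: u_def)
    then show ?thesis by (simp flip: power_mult_distrib mult.assoc)
  qed
  moreover have "D s u (-1) = (-1) powi (int k - 1) * (if s = r - k - 1 then 1 else 0)" "D s u 1 = 0"
    if "s < r" for s
    using Du[of s "-1"] Du[of s 1] bvp_towerD(3,4)[OF V that] that by auto
  ultimately have u: "bvp_solution r k lam u"
    unfolding bvp_solution_def by blast
  have "u_sol r k lam = u"
    unfolding u_sol_def
  proof (rule the_equality)
    show "bvp_solution r k lam u \<and> (\<forall>x. x \<notin> II \<longrightarrow> u x = 0)"
      using u by (simp add: u_def)
    fix v assume v: "bvp_solution r k lam v \<and> (\<forall>x. x \<notin> II \<longrightarrow> v x = 0)"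
    show "v = u"
    proof (rule ext)
      fix x show "v x = u x"
        using bvp_solution_unique[OF r lam _ u, of v x] v by (cases "x \<in> II") (auto simp: u_def)
    qed
  qed
  then show ?thesis using Du[OF j x] by simp
qed

section \<open>Deviation and best approximation\<close>

lemma bvp_tower_shift:
  assumes "bvp_tower r k lam V"
  shows "derivative_tower r (\<lambda>s. V (r + s))" "derivative_tower r (\<lambda>s. V (2 * r + s))"
    "derivative_tower r V"
  using derivative_tower_shift[OF bvp_towerD(1)[OF assms], of r r]
    derivative_tower_shift[OF bvp_towerD(1)[OF assms], of r "2 * r"]
    derivative_tower_le[OF bvp_towerD(1)[OF assms], of r] by simp_all

lemma D_left_representation:
  assumes V: "bvp_tower r k lam V" and r: "1 \<le> r" "k < r" and f: "f \<in> L2_Sobolev r"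
  shows "D_left k f = (LINT x|lebesgue_on II. V (2 * r) x * f x) -
     (-1) ^ r * (LINT x|lebesgue_on II. V r x * D r f x)"
proof -
  have "continuous_on II (V (r + r))" using bvp_tower_continuous[OF V r(1)] by simp
  from boundary_functional_Sobolev[OF r bvp_tower_shift(1)[OF V] this bvp_towerD(3,4)[OF V] f]
  show ?thesis by (simp add: D_left_def mult_2)
qed

text \<open>If \<open>V r\<close> vanished, so would its derivative of order
  \<open>r - k - 1\<close> at \<open>-1\<close>, which is prescribed to have modulus one. If
  \<open>V (2 * r)\<close> vanished, the zero data at \<open>1\<close> would force
  \<open>V r\<close> to vanish too.\<close>

lemma L2norm_bvp_tower_pos:
  assumes V: "bvp_tower r k lam V" and r: "1 \<le> r" "k < r"
  shows "0 < L2norm (V r)" "0 < L2norm (V (2 * r))"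
proof -
  note c = bvp_tower_continuous[OF V r(1)]
  show pos: "0 < L2norm (V r)"
  proof (rule ccontr)
    assume "\<not> 0 < L2norm (V r)"
    then have "L2norm (V r) = 0" using L2norm_nonneg[of "V r"] by linarith
    then have "V r x = 0" if "x \<in> II" for x
      using L2norm_eq_0[OF c, of r] that by simp
    then have "V (r + (r - k - 1)) (-1) = 0"
      using derivative_tower_0_eq_0[OF bvp_tower_shift(1)[OF V], of "r - k - 1" "-1"] r by simp
    then show False
      using bvp_towerD(3)[OF V, of "r - k - 1"] r by (simp add: neg_one_powi_diff_one)
  qed
  show "0 < L2norm (V (2 * r))"
  proof (rule ccontr)
    assume "\<not> 0 < L2norm (V (2 * r))"
    then have "L2norm (V (2 * r)) = 0" using L2norm_nonneg[of "V (2 * r)"] by linarith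
    then have "V (r + r) x = 0" if "x \<in> II" for x
      using L2norm_eq_0[OF c, of "2 * r"] that by (simp add: mult_2)
    then have "V r x = 0" if "x \<in> II" for x
      using derivative_tower_eq_0[OF bvp_tower_shift(1)[OF V] bvp_towerD(4)[OF V], where s = 0] that
      by simp
    then have "L2norm (V r) = L2norm (\<lambda>x. 0)" by (intro L2norm_cong) auto
    then show False using pos by (simp add: L2norm_eq)
  qed
qed

text \<open>The real \<open>SUP\<close> is an upper bound only if the quotients are bounded above,
  which the constant \<open>K\<close> from \<open>bounded_linear_L2\<close> ensures. When
  \<open>L2norm f = 0\<close> the quotient is \<open>0\<close> by the convention for division, so
  there the claim comes from \<open>K\<close> directly.\<close>

lemma onorm_L2_bound:
  assumes S: "bounded_linear_L2 S" and N: "onorm_L2 S \<le> N" and f: "f \<in> L2"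
  shows "\<bar>S f\<bar> \<le> N * L2norm f"
proof -
  obtain K where K: "\<And>f. f \<in> L2 \<Longrightarrow> \<bar>S f\<bar> \<le> K * L2norm f"
    using S unfolding bounded_linear_L2_def by blast
  show ?thesis
  proof (cases "L2norm f = 0")
    case True
    then show ?thesis using K[OF f] by simp
  next
    case False
    have "\<bar>S g\<bar> / L2norm g \<le> \<bar>K\<bar>" if "g \<in> L2" for g
    proof (cases "L2norm g = 0")
      case False
      then have "0 < L2norm g" using L2norm_nonneg[of g] by linarith
      moreover have "\<bar>S g\<bar> \<le> \<bar>K\<bar> * L2norm g"
        using K[OF that] by (rule order_trans) (simp add: mult_right_mono)
      ultimately show ?thesis by (simp add: field_simps)
    qed simp
    then have "bdd_above ((\<lambda>g. \<bar>S g\<bar> / L2norm g) ` L2)" by (intro bdd_aboveI2) auto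
    then have "\<bar>S f\<bar> / L2norm f \<le> onorm_L2 S"
      unfolding onorm_L2_def using f by (intro cSUP_upper)
    moreover have "0 < L2norm f" using False L2norm_nonneg[of f] by linarith
    ultimately have "\<bar>S f\<bar> \<le> onorm_L2 S * L2norm f" by (simp add: field_simps)
    also have "\<dots> \<le> N * L2norm f" using N by (intro mult_right_mono) auto
    finally show ?thesis .
  qed
qed

lemma L2_inner_bounded_linear:
  assumes g: "g \<in> L2"
  shows "bounded_linear_L2 (\<lambda>f. LINT x|lebesgue_on II. g x * f x)"
    "onorm_L2 (\<lambda>f. LINT x|lebesgue_on II. g x * f x) \<le> L2norm g"
proof -
  show "bounded_linear_L2 (\<lambda>f. LINT x|lebesgue_on II. g x * f x)"
    unfolding bounded_linear_L2_def
  proof (intro conjI ballI allI exI)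
    fix f h assume "f \<in> L2" "h \<in> L2"
    then show "(LINT x|lebesgue_on II. g x * (f x + h x)) =
        (LINT x|lebesgue_on II. g x * f x) + (LINT x|lebesgue_on II. g x * h x)"
      using g by (simp add: distrib_left L2_mult_integrable)
  next
    fix c f
    show "(LINT x|lebesgue_on II. g x * (c * f x)) = c * (LINT x|lebesgue_on II. g x * f x)"
      by (simp add: mult.left_commute)
  next
    fix f assume "f \<in> L2"
    then show "\<bar>LINT x|lebesgue_on II. g x * f x\<bar> \<le> L2norm g * L2norm f"
      by (rule L2_Cauchy_Schwarz[OF g])
  qed
  show "onorm_L2 (\<lambda>f. LINT x|lebesgue_on II. g x * f x) \<le> L2norm g"
    unfolding onorm_L2_def
  proof (rule cSUP_least)
    show "L2 \<noteq> {}" using g by auto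
    fix f assume f: "f \<in> L2"
    show "\<bar>LINT x|lebesgue_on II. g x * f x\<bar> / L2norm f \<le> L2norm g"
    proof (cases "L2norm f = 0")
      case False
      then have "0 < L2norm f" using L2norm_nonneg[of f] by linarith
      then show ?thesis using L2_Cauchy_Schwarz[OF g f] by (simp add: field_simps)
    qed simp
  qed
qed

section \<open>The deviation of \<open>S_left\<close> and its optimality for
  \<open>lam > 0\<close>\<close>

lemma S_left_eq:
  assumes V: "bvp_tower r k lam V" and r: "1 \<le> r" and lam: "0 \<le> lam"
  shows "S_left r k lam = (\<lambda>f. LINT x|lebesgue_on II. V (2 * r) x * f x)"
  unfolding S_left_def
  by (rule ext, rule lebesgue_on_II_cong) (simp add: D_u_sol[OF V r lam] mult_2)

lemma L2norm_u_sol: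
  assumes V: "bvp_tower r k lam V" and r: "1 \<le> r" and lam: "0 \<le> lam"
  shows "L2norm (u_sol r k lam) = L2norm (V r)" "L2norm (D r (u_sol r k lam)) = L2norm (V (2 * r))"
  using D_u_sol[OF V r lam, of 0] D_u_sol[OF V r lam, of r]
  by (auto intro!: L2norm_cong simp: mult_2)

lemma W2_tower:
  assumes F: "derivative_tower r F" "continuous_on II (F r)" and r: "1 \<le> r"
    and n: "L2norm (F r) \<le> 1"
  shows "F 0 \<in> W2 r"
proof -
  have "L2norm (D r (F 0)) = L2norm (F r)"
    by (rule L2norm_cong) (simp add: derivative_tower_D[OF F(1)])
  then show ?thesis
    using derivative_tower_L2_Sobolev[OF F(1) r F(2)] n by (simp add: W2_def)
qed

lemma deviation_S_left:
  assumes V: "bvp_tower r k lam V" and r: "1 \<le> r" "k < r" and lam: "0 \<le> lam"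
  shows "deviation (D_left k) (S_left r k lam) (W2 r) = ereal (L2norm (V r))"
proof -
  define n where "n = L2norm (V r)"
  have n: "0 < n" using L2norm_bvp_tower_pos[OF V r] by (simp add: n_def)
  have c: "continuous_on II (V r)" using bvp_tower_continuous[OF V r(1)] by simp
  have dev: "\<bar>D_left k f - S_left r k lam f\<bar> = \<bar>LINT x|lebesgue_on II. V r x * D r f x\<bar>"
    if "f \<in> L2_Sobolev r" for f
    using D_left_representation[OF V r that] by (simp add: S_left_eq[OF V r(1) lam] abs_mult)
  have "deviation (D_left k) (S_left r k lam) (W2 r) \<le> ereal n"
    unfolding deviation_def
  proof (rule SUP_least)
    fix f assume f: "f \<in> W2 r"
    then have fs: "f \<in> L2_Sobolev r" "D r f \<in> L2" by (auto simp: W2_def L2_Sobolev_def)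
    have "\<bar>LINT x|lebesgue_on II. V r x * D r f x\<bar> \<le> n * L2norm (D r f)"
      unfolding n_def by (rule L2_Cauchy_Schwarz[OF continuous_on_L2[OF c] fs(2)])
    also have "\<dots> \<le> n * 1"
      using n f by (intro mult_left_mono) (auto simp: W2_def)
    finally show "ereal \<bar>D_left k f - S_left r k lam f\<bar> \<le> ereal n"
      by (simp add: dev[OF fs(1)])
  qed
  moreover have "ereal n \<le> deviation (D_left k) (S_left r k lam) (W2 r)"
  proof -
    \<comment> \<open>\<open>V\<close> starts with an \<open>r\<close>-fold antiderivative of
      \<open>V r\<close>, so \<open>F r\<close> is \<open>V r\<close> scaled to norm one and the
      Cauchy-Schwarz inequality becomes an equality.\<close>
    define F where "F j x = 1 / n * V j x" for j x
    have F: "derivative_tower r F"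
      unfolding F_def[abs_def] by (intro derivative_tower_cmult bvp_tower_shift(3)[OF V])
    have Fc: "continuous_on II (F r)"
      unfolding F_def[abs_def] by (intro continuous_intros c)
    have "L2norm (F r) = 1"
      unfolding F_def[abs_def] L2norm_cmult using n by (simp add: n_def)
    then have FW: "F 0 \<in> W2 r" by (intro W2_tower F Fc r) simp
    have "(LINT x|lebesgue_on II. V r x * D r (F 0) x) = (LINT x|lebesgue_on II. 1 / n * (V r x)\<^sup>2)"
      by (rule lebesgue_on_II_cong)
         (simp add: derivative_tower_D[OF F] F_def power2_eq_square)
    also have "\<dots> = 1 / n * n\<^sup>2" by (simp add: n_def L2norm_power2)
    also have "\<dots> = n" using n by (simp add: power2_eq_square)
    finally have "\<bar>D_left k (F 0) - S_left r k lam (F 0)\<bar> = n"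
      using FW n by (subst dev) (auto simp: W2_def)
    then show ?thesis
      unfolding deviation_def using FW by (metis (no_types, lifting) SUP_upper)
  qed
  ultimately show ?thesis unfolding n_def by (rule antisym)
qed

lemma deviation_ge_of_pos:
  assumes V: "bvp_tower r k lam V" and r: "1 \<le> r" "k < r" and lam: "0 < lam"
    and S: "bounded_linear_L2 S" "onorm_L2 S \<le> L2norm (V (2 * r))"
  shows "ereal (L2norm (V r)) \<le> deviation (D_left k) S (W2 r)"
proof -
  define n where "n = L2norm (V r)"
  define N where "N = L2norm (V (2 * r))"
  have n: "0 < n" using L2norm_bvp_tower_pos[OF V r] by (simp add: n_def)
  note c = bvp_tower_continuous[OF V r(1)]
  \<comment> \<open>By the equation \<open>V (3 * r)\<close> is \<open>lam * V r\<close> up to sign,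
    so division by \<open>lam * n\<close> gives \<open>F r\<close> norm one.\<close>
  define F where "F j x = 1 / (lam * n) * V (2 * r + j) x" for j x
  have F: "derivative_tower r F"
    unfolding F_def[abs_def] by (intro derivative_tower_cmult bvp_tower_shift(2)[OF V])
  have Fc: "continuous_on II (F j)" if "j \<le> r" for j
    unfolding F_def[abs_def] using that by (intro continuous_intros c) auto
  have Fr: "F r x = - ((-1) ^ r / n) * V r x" for x
    using bvp_towerD(2)[OF V, of x] lam by (simp add: F_def field_simps)
  have "L2norm (F r) = 1"
    unfolding Fr[abs_def] L2norm_cmult using n by (simp add: n_def abs_divide)
  then have FW: "F 0 \<in> W2 r" by (intro W2_tower F Fc r) simp_all
  then have FS: "F 0 \<in> L2_Sobolev r" by (simp add: W2_def)
  have "(LINT x|lebesgue_on II. V (2 * r) x * F 0 x) = 1 / (lam * n) * N\<^sup>2"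
    unfolding N_def L2norm_power2 by (simp add: F_def power2_eq_square mult.left_commute)
  moreover have "(LINT x|lebesgue_on II. V r x * D r (F 0) x) = - ((-1) ^ r * n)"
  proof -
    have "(LINT x|lebesgue_on II. V r x * D r (F 0) x) =
      (LINT x|lebesgue_on II. - ((-1) ^ r / n) * (V r x)\<^sup>2)"
      by (rule lebesgue_on_II_cong) (simp add: derivative_tower_D[OF F] Fr power2_eq_square)
    also have "\<dots> = - ((-1) ^ r / n) * n\<^sup>2"
      unfolding n_def L2norm_power2 by (rule integral_mult_right_zero)
    also have "\<dots> = - ((-1) ^ r * n)" using n by (simp add: power2_eq_square)
    finally show ?thesis .
  qed
  ultimately have "D_left k (F 0) = 1 / (lam * n) * N\<^sup>2 + n"
    using D_left_representation[OF V r FS] by (simp flip: power_mult_distrib mult.assoc)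
  \<comment> \<open>The norm bound lets \<open>S\<close> match at most the first summand of
    \<open>D_left k (F 0)\<close>; a gap of at least \<open>n\<close> remains.\<close>
  moreover have "\<bar>S (F 0)\<bar> \<le> 1 / (lam * n) * N\<^sup>2"
  proof -
    have "\<bar>S (F 0)\<bar> \<le> N * L2norm (F 0)"
      using onorm_L2_bound[OF S continuous_on_L2[OF Fc[of 0]]] by (simp add: N_def)
    also have "L2norm (F 0) = 1 / (lam * n) * N"
      unfolding F_def[abs_def] L2norm_cmult using n lam by (simp add: N_def)
    finally show ?thesis by (simp add: power2_eq_square)
  qed
  ultimately have "n \<le> \<bar>D_left k (F 0) - S (F 0)\<bar>" by linarith
  then have "ereal n \<le> ereal \<bar>D_left k (F 0) - S (F 0)\<bar>" by simp
  also have "\<dots> \<le> deviation (D_left k) S (W2 r)"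
    unfolding deviation_def using FW by (rule SUP_upper)
  finally show ?thesis by (simp add: n_def)
qed

section \<open>Polynomials of degree less than \<open>r\<close>, the case \<open>lam = 0\<close> and
  the constant \<open>M_left\<close>\<close>

lemma derivative_tower_poly: "derivative_tower n (\<lambda>j. poly ((pderiv ^^ j) P))"
  by (auto simp: derivative_tower_def intro: has_field_derivative_at_within poly_DERIV)

lemma D_poly: "x \<in> II \<Longrightarrow> D j (poly P) x = poly ((pderiv ^^ j) P) x"
  using derivative_tower_D[OF derivative_tower_poly, of "poly P" P j j x] by simp

lemma higher_pderiv_eq_0:
  fixes P :: "real poly"
  shows "degree P < n \<Longrightarrow> (pderiv ^^ n) P = 0"
proof (induction n arbitrary: P)
  case (Suc n)
  show ?case
  proof (cases "degree P = 0")
    case True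
    then have "pderiv P = 0" by (simp add: pderiv_eq_0_iff)
    moreover have "(pderiv ^^ n) (0 :: real poly) = 0" by (induction n) auto
    ultimately show ?thesis by (simp add: funpow_Suc_right del: funpow.simps)
  next
    case False
    then show ?thesis
      using Suc by (simp add: funpow_Suc_right degree_pderiv del: funpow.simps)
  qed
qed simp

lemma poly_W2:
  assumes "1 \<le> r" "degree P \<le> r - 1"
  shows "poly P \<in> W2 r"
proof -
  have "(pderiv ^^ r) P = 0" using assms by (intro higher_pderiv_eq_0) auto
  then have "L2norm (poly ((pderiv ^^ r) P)) \<le> 1" by (simp add: L2norm_eq)
  from W2_tower[OF derivative_tower_poly _ assms(1) this] show ?thesis
    by (simp add: continuous_on_poly)
qed

text \<open>The \<open>r\<close>-th derivative of \<open>P\<close> vanishes, so all multiples of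
  \<open>P\<close> lie in \<open>W2 r\<close>, and a single discrepancy can be scaled beyond every
  bound.\<close>

lemma deviation_infinite:
  assumes r: "1 \<le> r" and S: "bounded_linear_L2 S"
    and P: "degree P \<le> r - 1" "D_left k (poly P) \<noteq> S (poly P)"
  shows "deviation (D_left k) S (W2 r) = \<infinity>"
proof (rule ereal_top)
  fix B :: real
  define d where "d = \<bar>D_left k (poly P) - S (poly P)\<bar>"
  have d: "0 < d" using P by (simp add: d_def)
  define c where "c = \<bar>B\<bar> / d"
  have pe: "poly (Polynomial.smult c P) = (\<lambda>x. c * poly P x)" by (rule ext) simp
  have "poly P \<in> L2" by (intro continuous_on_L2 continuous_intros)
  then have "S (poly (Polynomial.smult c P)) = c * S (poly P)"
    unfolding pe using S by (auto simp: bounded_linear_L2_def)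
  moreover have "D_left k (poly (Polynomial.smult c P)) = c * D_left k (poly P)"
    by (simp add: D_left_def D_poly higher_pderiv_smult)
  ultimately have "\<bar>D_left k (poly (Polynomial.smult c P)) - S (poly (Polynomial.smult c P))\<bar> = \<bar>c\<bar> * d"
    unfolding d_def by (simp add: abs_mult flip: right_diff_distrib)
  also have "\<dots> = \<bar>B\<bar>" using d by (simp add: c_def)
  finally have "ereal B \<le> ereal \<bar>D_left k (poly (Polynomial.smult c P)) - S (poly (Polynomial.smult c P))\<bar>" by simp
  also have "\<dots> \<le> deviation (D_left k) S (W2 r)"
    unfolding deviation_def
    by (intro SUP_upper poly_W2 r order_trans[OF degree_smult_le P(1)])
  finally show "ereal B \<le> deviation (D_left k) S (W2 r)" .
qed

lemma D_left_poly_representation: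
  assumes V: "bvp_tower r k lam V" and r: "1 \<le> r" "k < r" and P: "degree P \<le> r - 1"
  shows "D_left k (poly P) = (LINT x|lebesgue_on II. V (2 * r) x * poly P x)"
proof -
  have "(pderiv ^^ r) P = 0" using P r by (intro higher_pderiv_eq_0) auto
  then have "(LINT x|lebesgue_on II. V r x * D r (poly P) x) = (LINT x|lebesgue_on II. 0)"
    by (intro lebesgue_on_II_cong) (simp add: D_poly)
  then show ?thesis
    using D_left_representation[OF V r] poly_W2[OF r(1) P] by (simp add: W2_def)
qed

text \<open>A variational argument: squaring the norm bound at \<open>Q + t * f\<close> and
  cancelling the equal constant terms leaves a quadratic in \<open>t\<close> that is nonnegative and
  zero at \<open>t = 0\<close>. Its linear coefficient, the discrepancy at \<open>f\<close> times
  \<open>2 * (L2norm Q)\<^sup>2\<close>, must vanish.\<close>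

lemma functional_norm_attained_unique:
  assumes S: "bounded_linear_L2 S" "onorm_L2 S \<le> L2norm Q"
    and Q: "Q \<in> L2" "0 < L2norm Q" "S Q = (L2norm Q)\<^sup>2" and f: "f \<in> L2"
  shows "S f = (LINT x|lebesgue_on II. Q x * f x)"
proof -
  define N where "N = L2norm Q"
  define F where "F = L2norm f"
  define p where "p = (LINT x|lebesgue_on II. Q x * f x)"
  \<comment> \<open>Its square is the leading coefficient of that quadratic, which is nonnegative by
    the norm bound at \<open>f\<close>.\<close>
  define c where "c = sqrt (N\<^sup>2 * F\<^sup>2 - (S f)\<^sup>2)"
  have "\<bar>S f\<bar> \<le> N * F" unfolding N_def F_def by (rule onorm_L2_bound[OF S f])
  then have "(S f)\<^sup>2 \<le> N\<^sup>2 * F\<^sup>2"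
    using abs_le_square_iff[of "S f" "N * F"] by (simp add: power_mult_distrib)
  then have c2: "c\<^sup>2 = N\<^sup>2 * F\<^sup>2 - (S f)\<^sup>2" and c: "0 \<le> c" by (auto simp: c_def)
  have "0 \<le> 0\<^sup>2 + 2 * t * (N\<^sup>2 * (p - S f)) + t\<^sup>2 * c\<^sup>2" for t
  proof -
    have g: "(\<lambda>x. Q x + t * f x) \<in> L2" by (intro L2_add L2_cmult Q f)
    have "S (\<lambda>x. Q x + t * f x) = N\<^sup>2 + t * S f"
      using S(1) Q f L2_cmult[OF f, of t] by (simp add: bounded_linear_L2_def N_def)
    then have "\<bar>N\<^sup>2 + t * S f\<bar> \<le> N * L2norm (\<lambda>x. Q x + t * f x)"
      using onorm_L2_bound[OF S g] by (simp add: N_def)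
    then have "\<bar>N\<^sup>2 + t * S f\<bar>\<^sup>2 \<le> (N * L2norm (\<lambda>x. Q x + t * f x))\<^sup>2"
      by (rule power_mono) simp
    also have "\<dots> = N\<^sup>2 * (N\<^sup>2 + 2 * t * p + t\<^sup>2 * F\<^sup>2)"
      by (simp add: power_mult_distrib L2norm_power2_add_cmult[OF Q(1) f] N_def F_def p_def)
    finally show ?thesis
      unfolding c2 by (simp add: power2_sum power_mult_distrib algebra_simps power2_eq_square)
  qed
  from quadratic_nonneg_imp_abs_le[OF this _ c] have "N\<^sup>2 * (p - S f) = 0" by simp
  then show ?thesis using Q(2) by (simp add: N_def p_def)
qed

lemma deviation_ge_of_0:
  assumes V: "bvp_tower r k 0 V" and r: "1 \<le> r" "k < r"
    and S: "bounded_linear_L2 S" "onorm_L2 S \<le> L2norm (V (2 * r))"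
  shows "ereal (L2norm (V r)) \<le> deviation (D_left k) S (W2 r)"
proof -
  obtain Q where Q: "degree Q \<le> r - 1" "\<And>x. V (2 * r) x = poly Q x"
    using bvp_towerD(5)[OF V] by auto
  then have VQ: "V (2 * r) = poly Q" by blast
  have QL: "poly Q \<in> L2" by (intro continuous_on_L2 continuous_intros)
  show ?thesis
  \<comment> \<open>Agreement at the single polynomial \<open>Q\<close> is decisive: without it the
    deviation is infinite; with it \<open>S\<close> attains at \<open>Q\<close> the largest norm
    allowed and coincides with \<open>S_left\<close> on \<open>W2 r\<close>.\<close>
  proof (cases "D_left k (poly Q) = S (poly Q)")
    case False
    then show ?thesis using deviation_infinite[OF r(1) S(1) Q(1)] by simp
  next
    case True
    then have SQ: "S (poly Q) = (L2norm (poly Q))\<^sup>2"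
      using D_left_poly_representation[OF V r Q(1)]
      by (simp add: VQ L2norm_mult_self)
    have "S f = S_left r k 0 f" if "f \<in> W2 r" for f
    proof -
      have "f \<in> L2"
        using L2_Sobolev_continuous[of f r 0] that r by (auto simp: W2_def intro: continuous_on_L2)
      from functional_norm_attained_unique[OF S(1) _ QL _ SQ this]
      show ?thesis
        using S(2) L2norm_bvp_tower_pos(2)[OF V r] by (simp add: S_left_eq[OF V r(1)] VQ)
    qed
    then have "deviation (D_left k) S (W2 r) = deviation (D_left k) (S_left r k 0) (W2 r)"
      unfolding deviation_def by (intro SUP_cong) auto
    then show ?thesis using deviation_S_left[OF V r] by simp
  qed
qed

text \<open>The polynomial \<open>V (2 * r)\<close> represents the functional on polynomials of
  degree less than \<open>r\<close>. Cauchy-Schwarz makes its norm an admissible constant, and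
  testing at this polynomial itself shows that none is smaller. The second claim supplies violating
  polynomials for smaller constants.\<close>

lemma M_left_minimal:
  assumes V: "bvp_tower r k 0 V" and r: "1 \<le> r" "k < r"
  shows "M_left r k = L2norm (V (2 * r))"
    "(\<And>Q :: real poly. degree Q \<le> r - 1 \<Longrightarrow> \<bar>poly ((pderiv ^^ k) Q) (-1)\<bar> \<le> M * L2norm (poly Q))
      \<Longrightarrow> L2norm (V (2 * r)) \<le> M"
proof -
  obtain Q where Q: "degree Q \<le> r - 1" "\<And>x. V (2 * r) x = poly Q x"
    using bvp_towerD(5)[OF V] by auto
  then have VQ: "V (2 * r) = poly Q" by blast
  have rep: "poly ((pderiv ^^ k) P) (-1) = (LINT x|lebesgue_on II. poly Q x * poly P x)"
    if "degree P \<le> r - 1" for P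
    using D_left_poly_representation[OF V r that] D_poly[of "-1" k P] by (simp add: D_left_def VQ)
  have L: "poly P \<in> L2" for P by (intro continuous_on_L2 continuous_intros)
  show least: "L2norm (V (2 * r)) \<le> M"
    if "\<And>Q :: real poly. degree Q \<le> r - 1 \<Longrightarrow> \<bar>poly ((pderiv ^^ k) Q) (-1)\<bar> \<le> M * L2norm (poly Q)" for M
  proof -
    have "\<bar>(L2norm (poly Q))\<^sup>2\<bar> \<le> M * L2norm (poly Q)"
      using that[OF Q(1)] rep[OF Q(1)] by (simp add: L2norm_mult_self)
    then show ?thesis
      using L2norm_bvp_tower_pos(2)[OF V r] by (simp add: VQ power2_eq_square)
  qed
  show "M_left r k = L2norm (V (2 * r))"
    unfolding M_left_def
  proof (rule cInf_eq_minimum)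
    show "L2norm (V (2 * r)) \<in> {M. \<forall>Q :: real poly. degree Q \<le> r - 1 \<longrightarrow>
        \<bar>poly ((pderiv ^^ k) Q) (-1)\<bar> \<le> M * L2norm (poly Q)}"
      using rep L2_Cauchy_Schwarz[OF L L] by (auto simp: VQ)
  qed (use least in auto)
qed

text \<open>Some polynomial violates the inequality with constant \<open>N\<close>. A functional of
  norm at most \<open>N\<close> cannot match \<open>D_left k\<close> there, and one mismatch makes
  the deviation infinite.\<close>

lemma best_approx_infinite:
  assumes r: "1 \<le> r" "k < r" and N: "N < M_left r k"
  shows "best_approx N (D_left k) (W2 r) = \<infinity>"
proof -
  obtain V where V: "bvp_tower r k 0 V" using bvp_tower_exists[OF r(1), of 0 k] by auto
  obtain P :: "real poly" where P: "degree P \<le> r - 1"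
      "N * L2norm (poly P) < \<bar>poly ((pderiv ^^ k) P) (-1)\<bar>"
    using M_left_minimal(1)[OF V r] M_left_minimal(2)[OF V r, of N] N by force
  have "deviation (D_left k) S (W2 r) = \<infinity>" if "bounded_linear_L2 S" "onorm_L2 S \<le> N" for S
  proof (rule deviation_infinite[OF r(1) that(1) P(1)])
    have "poly P \<in> L2" by (intro continuous_on_L2 continuous_intros)
    from onorm_L2_bound[OF that this] P(2) show "D_left k (poly P) \<noteq> S (poly P)"
      by (auto simp: D_left_def D_poly)
  qed
  then have "\<infinity> \<le> best_approx N (D_left k) (W2 r)"
    unfolding best_approx_def by (intro INF_greatest) auto
  then show ?thesis by simp
qed

lemma best_approx_eq:
  assumes V: "bvp_tower r k lam V" and r: "1 \<le> r" "k < r" and lam: "0 \<le> lam"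
  shows "best_approx (L2norm (V (2 * r))) (D_left k) (W2 r) =
    deviation (D_left k) (S_left r k lam) (W2 r)"
proof (rule antisym)
  have "V (2 * r) \<in> L2"
    using bvp_tower_continuous[OF V r(1)] by (intro continuous_on_L2) auto
  from L2_inner_bounded_linear[OF this]
  show "best_approx (L2norm (V (2 * r))) (D_left k) (W2 r) \<le>
      deviation (D_left k) (S_left r k lam) (W2 r)"
    unfolding best_approx_def S_left_eq[OF V r(1) lam] by (intro INF_lower) auto
  show "deviation (D_left k) (S_left r k lam) (W2 r) \<le>
      best_approx (L2norm (V (2 * r))) (D_left k) (W2 r)"
    unfolding best_approx_def deviation_S_left[OF V r lam]
    using deviation_ge_of_pos[OF V r] deviation_ge_of_0[of r k V] V r lam
    by (intro INF_greatest) (cases "lam = 0"; auto)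
qed

section \<open>The norm of the solution as a function of the parameter\<close>

text \<open>The derivative of \<open>(x + 1) * (w x)\<^sup>2\<close> integrates to zero: the weight
  vanishes at \<open>-1\<close> and \<open>w\<close> vanishes at \<open>1\<close>. Cauchy-Schwarz
  and the bound \<open>2\<close> for the weight give the constant \<open>4\<close>.\<close>

lemma poincare_step:
  assumes w: "\<And>x. x \<in> II \<Longrightarrow> (w has_real_derivative w' x) (at x within II)"
    and w': "continuous_on II w'" and w1: "w 1 = 0"
  shows "L2norm w \<le> 4 * L2norm w'"
proof -
  have cw: "continuous_on II w"
    using w DERIV_continuous continuous_on_eq_continuous_within by blast
  define g where "g x = (x + 1) * w' x" for x
  have cg: "continuous_on II g" unfolding g_def by (intro continuous_intros w')
  have wL: "w \<in> L2" and gL: "g \<in> L2" using cw cg by (auto intro: continuous_on_L2)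
  have "((\<lambda>x. (w x)\<^sup>2 + 2 * (w x * g x)) has_integral (1 + 1) * (w 1)\<^sup>2 - (-1 + 1) * (w (-1))\<^sup>2) II"
  proof (rule fundamental_theorem_of_calculus)
    fix x :: real assume x: "x \<in> II"
    have "((\<lambda>x. (x + 1) * (w x)\<^sup>2) has_real_derivative
        (1 * (w x)\<^sup>2 + (x + 1) * (2 * w x * w' x))) (at x within II)"
      by (auto intro!: derivative_eq_intros w[OF x])
    also have "1 * (w x)\<^sup>2 + (x + 1) * (2 * w x * w' x) = (w x)\<^sup>2 + 2 * (w x * g x)"
      by (simp add: g_def)
    finally show "((\<lambda>x. (x + 1) * (w x)\<^sup>2) has_vector_derivative (w x)\<^sup>2 + 2 * (w x * g x)) (at x within II)"
      by (simp add: has_real_derivative_iff_has_vector_derivative)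
  qed simp
  moreover have "((\<lambda>x. (w x)\<^sup>2 + 2 * (w x * g x)) has_integral
      (L2norm w)\<^sup>2 + 2 * (LINT x|lebesgue_on II. w x * g x)) II"
    by (intro has_integral_add has_integral_L2norm[OF cw] has_integral_mult_right
        has_integral_integral_lebesgue_on L2_mult_integrable[OF wL gL]) auto
  ultimately have "(L2norm w)\<^sup>2 + 2 * (LINT x|lebesgue_on II. w x * g x) =
      (1 + 1) * (w 1)\<^sup>2 - (-1 + 1) * (w (-1))\<^sup>2"
    by (rule has_integral_unique[symmetric])
  then have "(L2norm w)\<^sup>2 \<le> 2 * (L2norm w * L2norm g)"
    using L2_Cauchy_Schwarz[OF wL gL] w1 by simp
  moreover have "L2norm g \<le> 2 * L2norm w'"
  proof (rule power2_le_imp_le)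
    have "(L2norm g)\<^sup>2 \<le> (L2norm (\<lambda>x. 2 * w' x))\<^sup>2"
    proof (rule has_integral_le[OF has_integral_L2norm[OF cg] has_integral_L2norm])
      show "continuous_on II (\<lambda>x. 2 * w' x)" by (intro continuous_intros w')
      fix x :: real assume "x \<in> II"
      then have "\<bar>g x\<bar> \<le> \<bar>2 * w' x\<bar>" by (auto simp: g_def abs_mult intro: mult_right_mono)
      then show "(g x)\<^sup>2 \<le> (2 * w' x)\<^sup>2" by (simp add: abs_le_square_iff)
    qed
    then show "(L2norm g)\<^sup>2 \<le> (2 * L2norm w')\<^sup>2" by (simp add: L2norm_cmult)
  qed simp
  then have "2 * (L2norm w * L2norm g) \<le> 2 * (L2norm w * (2 * L2norm w'))"
    by (intro mult_left_mono) auto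
  ultimately have "L2norm w * L2norm w \<le> L2norm w * (4 * L2norm w')"
    unfolding power2_eq_square by linarith
  then show ?thesis
    using L2norm_nonneg[of w] L2norm_nonneg[of w'] by (cases "L2norm w = 0") auto
qed

lemma poincare_tower:
  assumes "derivative_tower n U" "continuous_on II (U n)" "\<And>s. s < n \<Longrightarrow> U s 1 = 0"
  shows "L2norm (U 0) \<le> 4 ^ n * L2norm (U n)"
  using assms
proof (induction n)
  case (Suc n)
  have t: "derivative_tower n U" using Suc.prems by (auto intro: derivative_tower_le)
  have "L2norm (U 0) \<le> 4 ^ n * L2norm (U n)"
    using Suc.prems derivative_tower_continuous[OF Suc.prems(1), of n] by (intro Suc.IH t) auto
  also have "L2norm (U n) \<le> 4 * L2norm (U (Suc n))"
    using Suc.prems derivative_towerD[OF Suc.prems(1), of n]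
    by (intro poincare_step) auto
  finally show ?case by (simp add: mult_left_mono)
qed simp

text \<open>The difference of the two solutions satisfies homogeneous boundary conditions; the equation
  is tested against it.\<close>

lemma bvp_tower_lipschitz:
  assumes V: "bvp_tower r k lam V" and W: "bvp_tower r k mu W" and r: "1 \<le> r" and lam: "0 \<le> lam"
  shows "\<bar>L2norm (V (2 * r)) - L2norm (W (2 * r))\<bar> \<le> 4 ^ r * L2norm (W r) * \<bar>lam - mu\<bar>"
proof -
  define U where "U s x = V (r + s) x - W (r + s) x" for s x
  have U: "derivative_tower (2 * r) U"
    unfolding U_def[abs_def]
    by (intro derivative_tower_diff derivative_tower_shift[OF bvp_towerD(1)[OF V]]
        derivative_tower_shift[OF bvp_towerD(1)[OF W]]) auto
  have cU: "continuous_on II (U s)" if "s \<le> 2 * r" for s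
    unfolding U_def[abs_def] using that r
    by (intro continuous_intros bvp_tower_continuous[OF V] bvp_tower_continuous[OF W]) auto
  have cW: "continuous_on II (W r)" using bvp_tower_continuous[OF W r] by simp
  have bc: "U s (-1) = 0" "U s 1 = 0" if "s < r" for s
    using that bvp_towerD(3,4)[OF V] bvp_towerD(3,4)[OF W] by (auto simp: U_def)
  have Ur: "derivative_tower r U" using derivative_tower_le[OF U] by simp
  have Ur': "derivative_tower (r - 1) (\<lambda>j. U (r + j))"
    using r by (intro derivative_tower_shift[OF U]) auto
  have "abs_continuous_on II (U (r + (r - 1)))"
    using r cU[of "2 * r"] by (intro abs_continuous_on_tower[OF U]) auto
  moreover have "(U (r + (r - 1)) has_real_derivative U (r + r) x) (at x within II)" if "x \<in> II" for x
    using derivative_towerD[OF U, of "r + (r - 1)" x] r that by simp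
  ultimately have "((\<lambda>x. U r x * U (r + 0) x - (-1) ^ r * (U 0 x * U (r + r) x)) has_integral
     (\<Sum>j<r. (-1) ^ j * (U (r - Suc j) 1 * U (r + j) 1)) -
     (\<Sum>j<r. (-1) ^ j * (U (r - Suc j) (-1) * U (r + j) (-1)))) II"
    using integration_by_parts_tower[OF r Ur _ Ur', of "{}"] cU[of r] by simp
  \<comment> \<open>In the equation for the difference, \<open>lam * V r - mu * W r\<close> is split
    as \<open>lam * U 0 + (lam - mu) * W r\<close>, which isolates the change of parameter.\<close>
  moreover have "U r x * U (r + 0) x - (-1) ^ r * (U 0 x * U (r + r) x) =
      (U r x)\<^sup>2 + lam * (U 0 x)\<^sup>2 + (lam - mu) * (W r x * U 0 x)" for x
  proof -
    have "U (r + r) x = - ((-1) ^ r) * (lam * V r x - mu * W r x)"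
      using bvp_towerD(2)[OF V, of x] bvp_towerD(2)[OF W, of x]
      by (simp add: U_def mult_2[symmetric] algebra_simps)
    then have "(-1) ^ r * (U 0 x * U (r + r) x) = - (U 0 x * (lam * V r x - mu * W r x))"
      by (simp flip: mult.assoc power_mult_distrib add: mult.commute[of "(-1) ^ r"])
    then show ?thesis by (simp add: U_def power2_eq_square algebra_simps)
  qed
  ultimately have "((\<lambda>x. (U r x)\<^sup>2 + lam * (U 0 x)\<^sup>2 + (lam - mu) * (W r x * U 0 x)) has_integral 0) II"
    using bc by simp
  moreover have WL: "W r \<in> L2" and UL: "U 0 \<in> L2"
    using cW cU[of 0] by (auto intro: continuous_on_L2)
  have "((\<lambda>x. (U r x)\<^sup>2 + lam * (U 0 x)\<^sup>2 + (lam - mu) * (W r x * U 0 x)) has_integral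
      (L2norm (U r))\<^sup>2 + lam * (L2norm (U 0))\<^sup>2 + (lam - mu) * (LINT x|lebesgue_on II. W r x * U 0 x)) II"
    using r
    by (intro has_integral_add has_integral_mult_right has_integral_L2norm cU
        has_integral_integral_lebesgue_on L2_mult_integrable WL UL) auto
  ultimately have "(L2norm (U r))\<^sup>2 + lam * (L2norm (U 0))\<^sup>2 +
      (lam - mu) * (LINT x|lebesgue_on II. W r x * U 0 x) = 0"
    using has_integral_unique by blast
  moreover have "0 \<le> lam * (L2norm (U 0))\<^sup>2" using lam by simp
  ultimately have "(L2norm (U r))\<^sup>2 \<le> \<bar>(lam - mu) * (LINT x|lebesgue_on II. W r x * U 0 x)\<bar>" by linarith
  also have "\<dots> \<le> \<bar>lam - mu\<bar> * (L2norm (W r) * L2norm (U 0))"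
    unfolding abs_mult by (intro mult_left_mono L2_Cauchy_Schwarz WL UL) auto
  \<comment> \<open>With \<open>U 0\<close> bounded by \<open>U r\<close>, one factor
    \<open>L2norm (U r)\<close> cancels, and the resulting Lipschitz constant involves
    \<open>W\<close> but not \<open>V\<close>.\<close>
  also have "\<dots> \<le> \<bar>lam - mu\<bar> * (L2norm (W r) * (4 ^ r * L2norm (U r)))"
    using poincare_tower[OF Ur cU[of r] bc(2)] by (intro mult_left_mono) auto
  finally have "L2norm (U r) * L2norm (U r) \<le> L2norm (U r) * (4 ^ r * L2norm (W r) * \<bar>lam - mu\<bar>)"
    by (simp add: power2_eq_square algebra_simps)
  then have Un: "L2norm (U r) \<le> 4 ^ r * L2norm (W r) * \<bar>lam - mu\<bar>"
    using L2norm_nonneg[of "U r"] by (cases "L2norm (U r) = 0") auto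
  have "\<bar>L2norm (V (2 * r)) - L2norm (W (2 * r))\<bar> \<le> L2norm (\<lambda>x. V (2 * r) x - W (2 * r) x)"
    using r by (intro L2norm_diff_le continuous_on_L2 bvp_tower_continuous[OF V] bvp_tower_continuous[OF W]) auto
  also have "\<dots> = L2norm (U r)" by (simp add: U_def[abs_def] mult_2)
  finally show ?thesis using Un by linarith
qed

text \<open>The affine map fixes \<open>-1\<close> and shrinks \<open>II\<close> to its initial
  segment of length \<open>2 / a\<close>. Substitution multiplies the squared norm over that segment
  by \<open>a\<close>.\<close>

lemma L2norm_scale:
  assumes h: "continuous_on II h" and a: "1 \<le> a"
  shows "L2norm (\<lambda>x. h ((x + 1) / a - 1)) \<le> sqrt a * L2norm h"
proof (rule power2_le_imp_le)
  define i where "i = integral {-1..-1 + 2 / a} (\<lambda>x. (h x)\<^sup>2)"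
  have sub: "{-1..-1 + 2 / a} \<subseteq> II" using a by (auto simp: field_simps)
  have c: "continuous_on II (\<lambda>x. h ((x + 1) / a - 1))"
    using a by (intro continuous_on_compose2[OF h] continuous_intros) (auto simp: field_simps)
  have int: "(\<lambda>x. (h x)\<^sup>2) integrable_on {-1..-1 + 2 / a}"
    by (intro integrable_continuous_real continuous_intros continuous_on_subset[OF h sub])
  have "((\<lambda>x. (h ((1 / a) *\<^sub>R x + (1 / a - 1)))\<^sup>2) has_integral (i /\<^sub>R (1 / a) ^ DIM(real)))
      (cbox ((-1 - (1 / a - 1)) /\<^sub>R (1 / a)) ((-1 + 2 / a - (1 / a - 1)) /\<^sub>R (1 / a)))"
  proof (rule has_integral_affinity'[where f = "\<lambda>x. (h x)\<^sup>2"])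
    show "((\<lambda>x. (h x)\<^sup>2) has_integral i) (cbox (-1) (-1 + 2 / a))"
      using int by (simp add: i_def has_integral_integral)
  qed (use a in simp)
  moreover have "(-1 - (1 / a - 1)) /\<^sub>R (1 / a) = -1" "(-1 + 2 / a - (1 / a - 1)) /\<^sub>R (1 / a) = 1"
    "i /\<^sub>R (1 / a) ^ DIM(real) = a * i"
    using a by (auto simp: field_simps)
  moreover have "(1 / a) *\<^sub>R x + (1 / a - 1) = (x + 1) / a - 1" for x
    by (simp add: add_divide_distrib)
  ultimately have "((\<lambda>x. (h ((x + 1) / a - 1))\<^sup>2) has_integral a * i) II"
    by (simp only: cbox_interval)
  then have "(L2norm (\<lambda>x. h ((x + 1) / a - 1)))\<^sup>2 = a * i"
    using has_integral_L2norm[OF c] by (rule has_integral_unique[rotated])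
  also have "i \<le> (L2norm h)\<^sup>2"
    unfolding i_def using has_integral_L2norm[OF h] int sub
    by (intro has_integral_subset_le[OF sub integrable_integral]) auto
  finally show "(L2norm (\<lambda>x. h ((x + 1) / a - 1)))\<^sup>2 \<le> (sqrt a * L2norm h)\<^sup>2"
    using a by (simp add: power_mult_distrib)
qed (use a in simp)

text \<open>The estimate for the solution with \<open>lam = 0\<close>, transplanted to a short interval at \<open>-1\<close>.\<close>

lemma interpolation_inequality:
  assumes r: "1 \<le> r" "k < r" and eps: "0 < eps"
  shows "\<exists>K\<ge>0. \<forall>F. derivative_tower r F \<and> continuous_on II (F r) \<longrightarrow>
    \<bar>F k (-1)\<bar> \<le> K * L2norm (F 0) + eps * L2norm (F r)"
proof -
  obtain V where V: "bvp_tower r k 0 V" using bvp_tower_exists[OF r(1), of 0 k] by auto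
  define A where "A = L2norm (V (2 * r))"
  define B where "B = L2norm (V r)"
  have AB: "0 \<le> A" "0 \<le> B" by (simp_all add: A_def B_def)
  \<comment> \<open>\<open>a\<close> is the magnification at \<open>-1\<close>. Taking it to be a
    square gives \<open>sqrt a = b\<close>, and \<open>b\<close> is large enough that
    \<open>B \<le> eps * b\<close>.\<close>
  define b where "b = max 1 (B / eps)"
  define a where "a = b\<^sup>2"
  have b: "1 \<le> b" "B \<le> eps * b"
    using eps by (auto simp: b_def max_def field_simps)
  have a: "1 \<le> a" "sqrt a = b" using b by (auto simp: a_def)
  show ?thesis
  proof (intro exI[of _ "a ^ k * (A * b)"] conjI allI impI)
    show "0 \<le> a ^ k * (A * b)" using a b AB by simp
    fix F :: "nat \<Rightarrow> real \<Rightarrow> real" assume "derivative_tower r F \<and> continuous_on II (F r)"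
    then have F: "derivative_tower r F" and Fr: "continuous_on II (F r)" by auto
    have cF: "continuous_on II (F j)" if "j \<le> r" for j
      using derivative_tower_continuous[OF F, of j] Fr that by (cases "j = r") auto
    define \<phi> where "\<phi> x = (x + 1) / a - 1" for x :: real
    \<comment> \<open>On \<open>II\<close> the function \<open>G 0\<close> sees only the values of
      \<open>F 0\<close> on the initial segment of length \<open>2 / a\<close>; the powers of
      \<open>1 / a\<close> come from the chain rule.\<close>
    define G where "G j x = (1 / a) ^ j * F j (\<phi> x)" for j x
    have \<phi>: "\<phi> x \<in> II" if "x \<in> II" for x using that a(1) by (auto simp: \<phi>_def field_simps)
    have G: "derivative_tower r G"
      unfolding derivative_tower_def
    proof (intro allI impI ballI)
      fix j x assume j: "j < r" and x: "x \<in> II"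
      have "(F j has_real_derivative F (Suc j) (\<phi> x)) (at (\<phi> x) within \<phi> ` II)"
        by (rule has_field_derivative_subset[OF derivative_towerD[OF F j \<phi>[OF x]]]) (use \<phi> in auto)
      moreover have "(\<phi> has_real_derivative 1 / a) (at x within II)"
        unfolding \<phi>_def[abs_def] using a(1) by (auto intro!: derivative_eq_intros)
      ultimately have "((F j \<circ> \<phi>) has_real_derivative F (Suc j) (\<phi> x) * (1 / a)) (at x within II)"
        by (rule DERIV_image_chain)
      from DERIV_cmult[OF this, of "(1 / a) ^ j"]
      show "(G j has_real_derivative G (Suc j) x) (at x within II)"
        by (simp add: G_def[abs_def] o_def mult_ac)
    qed
    have cG: "continuous_on II (G r)"
      unfolding G_def[abs_def] \<phi>_def using \<phi> a(1)
      by (intro continuous_intros continuous_on_compose2[OF cF]) (auto simp: \<phi>_def)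
    have nG: "L2norm (G j) \<le> (1 / a) ^ j * (b * L2norm (F j))" if "j \<le> r" for j
      unfolding G_def[abs_def] L2norm_cmult \<phi>_def
      using L2norm_scale[OF cF[OF that] a(1)] a b
      by (simp add: power_abs divide_right_mono power_divide)
    have GS: "G 0 \<in> L2_Sobolev r" by (rule derivative_tower_L2_Sobolev[OF G r(1) cG]) simp
    have "G k (-1) = D_left k (G 0)"
      unfolding D_left_def using r by (intro derivative_tower_D[OF G, symmetric]) auto
    also have "\<dots> = (LINT x|lebesgue_on II. V (2 * r) x * G 0 x) -
        (-1) ^ r * (LINT x|lebesgue_on II. V r x * G r x)"
    proof -
      have "(LINT x|lebesgue_on II. V r x * D r (G 0) x) = (LINT x|lebesgue_on II. V r x * G r x)"
        by (rule lebesgue_on_II_cong) (simp add: derivative_tower_D[OF G])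
      then show ?thesis using D_left_representation[OF V r GS] by simp
    qed
    finally have "\<bar>G k (-1)\<bar> \<le> \<bar>LINT x|lebesgue_on II. V (2 * r) x * G 0 x\<bar> +
        \<bar>(-1) ^ r * (LINT x|lebesgue_on II. V r x * G r x)\<bar>"
      by linarith
    also have "\<dots> = \<bar>LINT x|lebesgue_on II. V (2 * r) x * G 0 x\<bar> +
        \<bar>LINT x|lebesgue_on II. V r x * G r x\<bar>"
      by (simp add: abs_mult)
    also have "\<dots> \<le> A * L2norm (G 0) + B * L2norm (G r)"
      unfolding A_def B_def
      by (intro add_mono L2_Cauchy_Schwarz continuous_on_L2 bvp_tower_continuous[OF V r(1)] cG
          derivative_tower_continuous[OF G]) (use r in auto)
    also have "\<dots> \<le> A * (b * L2norm (F 0)) + B * ((1 / a) ^ r * (b * L2norm (F r)))"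
      using nG[of 0] nG[of r] AB by (intro add_mono mult_left_mono) auto
    finally have "\<bar>G k (-1)\<bar> \<le> A * (b * L2norm (F 0)) + B * ((1 / a) ^ r * (b * L2norm (F r)))" .
    moreover have "\<bar>F k (-1)\<bar> = a ^ k * \<bar>G k (-1)\<bar>"
      using a(1) by (simp add: G_def \<phi>_def abs_mult power_divide)
    ultimately have "\<bar>F k (-1)\<bar> \<le>
        a ^ k * (A * (b * L2norm (F 0)) + B * ((1 / a) ^ r * (b * L2norm (F r))))"
      using a(1) by (simp add: mult_left_mono)
    also have "\<dots> = a ^ k * (A * b) * L2norm (F 0) + (a ^ k * (1 / a) ^ r) * (b * B * L2norm (F r))"
      by (simp add: algebra_simps)
    \<comment> \<open>As \<open>k < r\<close>, a factor \<open>1 / a\<close> survives. It cancels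
      two factors \<open>b\<close>, one from rescaling the norm and one from
      \<open>B \<le> eps * b\<close>.\<close>
    also have "\<dots> \<le> a ^ k * (A * b) * L2norm (F 0) + (1 / a) * (b * (eps * b) * L2norm (F r))"
    proof (intro add_mono mult_mono order_refl)
      have "(1 / a) ^ r \<le> (1 / a) ^ Suc k"
        using a(1) r by (intro power_decreasing) auto
      then have "a ^ k * (1 / a) ^ r \<le> a ^ k * (1 / a) ^ Suc k"
        using a(1) by (intro mult_left_mono) auto
      also have "\<dots> = 1 / a" using a(1) by (simp add: power_divide)
      finally show "a ^ k * (1 / a) ^ r \<le> 1 / a" .
    qed (use a b AB eps in auto)
    also have "(1 / a) * (b * (eps * b) * L2norm (F r)) = eps * L2norm (F r)"
      using b by (simp add: a_def power2_eq_square)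
    finally show "\<bar>F k (-1)\<bar> \<le> a ^ k * (A * b) * L2norm (F 0) + eps * L2norm (F r)" .
  qed
qed

text \<open>The representation of \<open>D_left\<close> is applied to \<open>V (2 * r)\<close>,
  whose \<open>r\<close>-th derivative is a multiple of \<open>V r\<close> by the equation, so both
  integrals become squared norms.\<close>

lemma bvp_tower_energy:
  assumes V: "bvp_tower r k lam V" and r: "1 \<le> r" "k < r"
  shows "V (2 * r + k) (-1) = (L2norm (V (2 * r)))\<^sup>2 + lam * (L2norm (V r))\<^sup>2"
proof -
  note t = bvp_tower_shift(2)[OF V]
  have S: "V (2 * r) \<in> L2_Sobolev r"
    using bvp_tower_continuous[OF V r(1)] r by (intro derivative_tower_L2_Sobolev[OF t]) auto
  have "D r (V (2 * r)) x = - ((-1) ^ r * lam) * V r x" if "x \<in> II" for x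
    using derivative_tower_D[OF t, of "V (2 * r)" r x] bvp_towerD(2)[OF V, of x] that by simp
  then have "(LINT x|lebesgue_on II. V r x * D r (V (2 * r)) x) =
      (LINT x|lebesgue_on II. - ((-1) ^ r * lam) * (V r x)\<^sup>2)"
    by (intro lebesgue_on_II_cong) (simp add: power2_eq_square)
  also have "\<dots> = - ((-1) ^ r * lam) * (L2norm (V r))\<^sup>2"
    unfolding L2norm_power2 by (rule integral_mult_right_zero)
  finally have "D_left k (V (2 * r)) = (L2norm (V (2 * r)))\<^sup>2 + lam * (L2norm (V r))\<^sup>2"
    using D_left_representation[OF V r S]
    by (simp add: L2norm_mult_self flip: mult.assoc power_mult_distrib)
  moreover have "D_left k (V (2 * r)) = V (2 * r + k) (-1)"
    unfolding D_left_def using r by (intro derivative_tower_D[OF t]) auto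
  ultimately show ?thesis by simp
qed

text \<open>If \<open>L2norm (V (2 * r))\<close> stayed bounded, then the interpolation inequality for \<open>V r\<close>, whose derivative
  of order \<open>r - k - 1\<close> at \<open>-1\<close> is \<open>\<plusminus>1\<close>, would keep \<open>L2norm (V r)\<close> away from \<open>0\<close>, while the one for
  \<open>V (2 * r)\<close> would force it to be small for large \<open>lam\<close>.\<close>

lemma bvp_tower_norm_unbounded:
  assumes r: "1 \<le> r" "k < r"
  shows "\<exists>lam\<ge>0. \<exists>V. bvp_tower r k lam V \<and> C < L2norm (V (2 * r))"
proof (rule ccontr)
  assume "\<not> ?thesis"
  then have C: "L2norm (V (2 * r)) \<le> C" if "0 \<le> lam" "bvp_tower r k lam V" for lam V
    using that by force
  obtain V0 where "bvp_tower r k 0 V0" using bvp_tower_exists[OF r(1), of 0 k] by auto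
  then have C0: "0 < C"
    using C[of 0 V0] L2norm_bvp_tower_pos(2)[of r k 0 V0] r by linarith
  have k': "r - k - 1 < r" using r by simp
  \<comment> \<open>With weight \<open>1 / (2 * C)\<close> the top derivative accounts for at most
    \<open>1 / 2\<close> of a boundary value of modulus one; the other half bounds
    \<open>L2norm (V r)\<close> from below.\<close>
  obtain K1 where K1: "0 \<le> K1" "\<And>F. derivative_tower r F \<Longrightarrow> continuous_on II (F r) \<Longrightarrow>
      \<bar>F (r - k - 1) (-1)\<bar> \<le> K1 * L2norm (F 0) + 1 / (2 * C) * L2norm (F r)"
    using interpolation_inequality[OF r(1) k', of "1 / (2 * C)"] C0 by auto
  define \<delta> where "\<delta> = 1 / (2 * (K1 + 1))"
  have \<delta>: "0 < \<delta>" using K1 by (simp add: \<delta>_def)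
  have lower: "\<delta> \<le> L2norm (V r)" if "0 \<le> lam" "bvp_tower r k lam V" for lam V
  proof -
    note V = that(2)
    have "\<bar>V (r + (r - k - 1)) (-1)\<bar> \<le> K1 * L2norm (V (r + 0)) + 1 / (2 * C) * L2norm (V (r + r))"
      using bvp_tower_continuous[OF V r(1)] by (intro K1(2)[OF bvp_tower_shift(1)[OF V]]) auto
    moreover have "\<bar>V (r + (r - k - 1)) (-1)\<bar> = 1"
      using bvp_towerD(3)[OF V k'] by (simp add: neg_one_powi_diff_one)
    moreover have "1 / (2 * C) * L2norm (V (r + r)) \<le> 1 / 2"
    proof -
      have "L2norm (V (r + r)) \<le> C" using C[OF that] by (simp add: mult_2)
      then have "1 / (2 * C) * L2norm (V (r + r)) \<le> 1 / (2 * C) * C"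
        using C0 by (intro mult_left_mono) auto
      then show ?thesis using C0 by simp
    qed
    moreover have "K1 * L2norm (V (r + 0)) \<le> (K1 + 1) * L2norm (V r)"
      by (simp add: mult_right_mono)
    ultimately have "1 / 2 \<le> (K1 + 1) * L2norm (V r)" by linarith
    then show ?thesis using K1(1) by (simp add: \<delta>_def field_simps)
  qed
  \<comment> \<open>With weight \<open>\<delta> / 2\<close> the term of the top derivative is
    \<open>\<delta> / 2 * (lam * t)\<close>. As \<open>\<delta> \<le> t\<close>, the energy term
    \<open>lam * t\<^sup>2\<close> absorbs it.\<close>
  obtain K2 where K2: "0 \<le> K2" "\<And>F. derivative_tower r F \<Longrightarrow> continuous_on II (F r) \<Longrightarrow>
      \<bar>F k (-1)\<bar> \<le> K2 * L2norm (F 0) + \<delta> / 2 * L2norm (F r)"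
    using interpolation_inequality[OF r, of "\<delta> / 2"] \<delta> by auto
  \<comment> \<open>Chosen so that \<open>lam * \<delta>\<^sup>2 / 2\<close> equals
    \<open>K2 * C + 1\<close>, one more than the upper bound to be contradicted.\<close>
  define lam where "lam = 2 * (K2 * C + 1) / \<delta>\<^sup>2"
  have lam: "0 \<le> lam" using K2 C0 by (simp add: lam_def)
  obtain V where V: "bvp_tower r k lam V" using bvp_tower_exists[OF r(1) lam] by auto
  define t where "t = L2norm (V r)"
  have t: "\<delta> \<le> t" using lower[OF lam V] by (simp add: t_def)
  have "\<bar>V (2 * r + k) (-1)\<bar> \<le> K2 * L2norm (V (2 * r + 0)) + \<delta> / 2 * L2norm (V (2 * r + r))"
    using bvp_tower_continuous[OF V r(1)] by (intro K2(2)[OF bvp_tower_shift(2)[OF V]]) auto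
  moreover have Vt: "L2norm (V (2 * r + r)) = lam * t"
  proof -
    have "V (2 * r + r) = (\<lambda>x. - ((-1) ^ r * lam) * V r x)"
      using bvp_towerD(2)[OF V] by auto
    then show ?thesis using lam by (simp only: L2norm_cmult t_def) (simp add: abs_mult)
  qed
  moreover have "K2 * L2norm (V (2 * r + 0)) \<le> K2 * C"
    using C[OF lam V] K2(1) by (simp add: mult_left_mono)
  moreover have "lam * t\<^sup>2 \<le> \<bar>V (2 * r + k) (-1)\<bar>"
    using bvp_tower_energy[OF V r] zero_le_power2[of "L2norm (V (2 * r))"] unfolding t_def by linarith
  ultimately have "lam * t\<^sup>2 \<le> K2 * C + \<delta> / 2 * (lam * t)" unfolding Vt by linarith
  then have "lam * (t * (t - \<delta> / 2)) \<le> K2 * C"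
    by (simp add: algebra_simps power2_eq_square)
  moreover have "lam * (\<delta> * (\<delta> / 2)) \<le> lam * (t * (t - \<delta> / 2))"
    using t \<delta> lam by (intro mult_left_mono mult_mono) auto
  moreover have "lam * (\<delta> * (\<delta> / 2)) = K2 * C + 1"
    using \<delta> by (simp add: lam_def power2_eq_square)
  ultimately show False by linarith
qed

lemma u_sol_norm_surj:
  assumes r: "1 \<le> r" "k < r" and N: "M_left r k \<le> N"
  shows "\<exists>lam\<ge>0. N = L2norm (D r (u_sol r k lam))"
proof -
  define g where "g lam = L2norm (D r (u_sol r k lam))" for lam
  have g: "g lam = L2norm (V (2 * r))" if "bvp_tower r k lam V" "0 \<le> lam" for lam V
    using L2norm_u_sol(2)[OF that(1) r(1) that(2)] by (simp add: g_def)
  obtain V0 where V0: "bvp_tower r k 0 V0" using bvp_tower_exists[OF r(1), of 0 k] by auto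
  \<comment> \<open>At \<open>lam = 0\<close> the norm is exactly \<open>M_left r k\<close>, the
    left end of the range.\<close>
  have g0: "g 0 \<le> N" using g[OF V0] M_left_minimal(1)[OF V0 r] N by simp
  obtain L V where L: "0 \<le> L" and V: "bvp_tower r k L V" "N < L2norm (V (2 * r))"
    using bvp_tower_norm_unbounded[OF r] by blast
  have gL: "N \<le> g L" using g[OF V(1) L] V(2) by simp
  have "continuous_on {0..L} g"
    unfolding continuous_on_iff
  proof (intro ballI allI impI)
    fix mu e :: real assume mu: "mu \<in> {0..L}" and e: "0 < e"
    obtain W where W: "bvp_tower r k mu W" using bvp_tower_exists[OF r(1), of mu k] mu by auto
    \<comment> \<open>The Lipschitz constant depends on the base point \<open>mu\<close> alone,
      which gives continuity there; the added \<open>1\<close> keeps it positive for the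
      division.\<close>
    define c where "c = 4 ^ r * L2norm (W r) + 1"
    have c: "0 < c" by (simp add: c_def add_nonneg_pos)
    have "dist (g lam) (g mu) < e" if lam: "lam \<in> {0..L}" "dist lam mu < e / c" for lam
    proof -
      obtain V where V: "bvp_tower r k lam V" using bvp_tower_exists[OF r(1), of lam k] lam by auto
      have "dist (g lam) (g mu) \<le> 4 ^ r * L2norm (W r) * \<bar>lam - mu\<bar>"
        using bvp_tower_lipschitz[OF V W r(1)] g[OF V] g[OF W] lam mu by (simp add: dist_real_def)
      also have "\<dots> \<le> c * \<bar>lam - mu\<bar>" by (intro mult_right_mono) (auto simp: c_def)
      also have "\<dots> < e" using lam(2) c by (simp add: dist_real_def field_simps)
      finally show ?thesis .
    qed
    then show "\<exists>d>0. \<forall>x'\<in>{0..L}. dist x' mu < d \<longrightarrow> dist (g x') (g mu) < e"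
      using e c by (intro exI[of _ "e / c"]) auto
  qed
  from IVT'[OF g0 gL L this] show ?thesis by (auto simp: g_def)
qed

text \<open>The existence clause justifies speaking of a parameter belonging to \<open>N\<close>.
  The formula is then asserted for every such parameter, so the outcome does not depend on a
  choice.\<close>

theorem theorem3:
  fixes r k :: nat
  assumes "1 \<le> r" and "k \<le> r - 1"
  shows "(\<forall>N. 0 \<le> N \<and> N < M_left r k \<longrightarrow> best_approx N (D_left k) (W2 r) = \<infinity>)
    \<and> (\<forall>N. M_left r k \<le> N \<longrightarrow>
         (\<exists>lam\<ge>0. N = L2norm (D r (u_sol r k lam)))
         \<and> (\<forall>lam\<ge>0. N = L2norm (D r (u_sol r k lam)) \<longrightarrow>
               best_approx N (D_left k) (W2 r) = deviation (D_left k) (S_left r k lam) (W2 r)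
             \<and> deviation (D_left k) (S_left r k lam) (W2 r) = ereal (L2norm (u_sol r k lam))))"
proof -
  have r: "1 \<le> r" "k < r" using assms by auto
  have "best_approx (L2norm (D r (u_sol r k lam))) (D_left k) (W2 r) =
        deviation (D_left k) (S_left r k lam) (W2 r)"
      "deviation (D_left k) (S_left r k lam) (W2 r) = ereal (L2norm (u_sol r k lam))"
    if "0 \<le> lam" for lam
  proof -
    obtain V where V: "bvp_tower r k lam V" using bvp_tower_exists[OF r(1) \<open>0 \<le> lam\<close>] by blast
    show "best_approx (L2norm (D r (u_sol r k lam))) (D_left k) (W2 r) =
        deviation (D_left k) (S_left r k lam) (W2 r)"
      "deviation (D_left k) (S_left r k lam) (W2 r) = ereal (L2norm (u_sol r k lam))"
      using best_approx_eq[OF V r that] deviation_S_left[OF V r that] L2norm_u_sol[OF V r(1) that]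
      by simp_all
  qed
  then show ?thesis
    using best_approx_infinite[OF r] u_sol_norm_surj[OF r] by blast
qed

end
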